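(* Let $L=\mathrm{Cur}(\mathrm{sl}_2(\mathbb{C}))$. For a skew-symmetric solution $r\in L\otimes L$ to the conformal classical Yang--Baxter equation on $L$, let $P^r_0$ be the associated Rota--Baxter operator of weight $0$ on $L$, i.e. writing $r=\sum_{i,j\in\{e,f,h\}}A_{ij}(\partial_{\otimes 1},\partial_{\otimes 2})\, i\otimes j$ with $A_{ij}$ polynomials in two variables, let $P^r_0$ be the $\partial$-linear map with $$P^r_0(u)=\sum_{i,j\in\{e,f,h\}}A_{ij}(-\partial,\partial)\,\langle i,u\rangle\, j,\qquad u\in\mathrm{sl}_2(\mathbb{C}).$$ Then: 1. For every skew-symmetric solution $r$, up to conjugation with an automorphism of $L$, the operator $P^r_0$ is either the $\partial$-linear extension of a Rota--Baxter operator of weight $0$ on $\mathrm{sl}_2(\mathbb{C})$, or one of the following $\partial$-linear maps with a nonzero odd polynomial $q(\partial)\in\mathbb{C}[\partial]$: (R1) $R(e) = 0$, $R(f) = q(\partial)e + \alpha h$, $R(h) = -2\alpha e$, where $\alpha\in\mathbb{C}$; (R2) $R(e) = R(f) = 0$, $R(h) = q(\partial)h$. 2. Conversely, every operator of the form (R1) (with any $\alpha\in\mathbb{C}$) or (R2) with $q(\partial)$ a nonzero odd polynomial equals $P^r_0$, up to conjugation with an automorphism of $L$, for some skew-symmetric solution $r$ to the conformal classical Yang--Baxter equation on $L$.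
   Context: All vector spaces are over $\mathbb{C}$. Fix the basis $e,f,h$ of $\mathrm{sl}_2(\mathbb{C})$ with $[e,f]=h$, $[h,e]=2e$, $[h,f]=-2f$; $\langle\cdot,\cdot\rangle$ denotes the Killing form of $\mathrm{sl}_2(\mathbb{C})$. A polynomial $q$ is odd if $q(-\partial)=-q(\partial)$. A Rota--Baxter operator of weight $0$ on a Lie algebra $\mathfrak{g}$ is a linear map $R$ with $[R(a),R(b)] = R([R(a),b]+[a,R(b)])$ for all $a,b\in\mathfrak{g}$. For a Lie algebra $\mathfrak{g}$, the current Lie conformal algebra $\mathrm{Cur}(\mathfrak{g})$ is the free $\mathbb{C}[\partial]$-module $\mathbb{C}[\partial]\mathfrak{g}=\mathbb{C}[\partial]\otimes\mathfrak{g}$ with $\lambda$-bracket $[\cdot_\lambda\cdot]:L\otimes L\to\mathbb{C}[\lambda]\otimes L$ given by $[f(\partial)a_\lambda g(\partial)b]=f(-\lambda)g(\lambda+\partial)[a,b]$ for $a,b\in\mathfrak{g}$ and polynomials $f,g$. An automorphism of $L$ is a bijective $\mathbb{C}[\partial]$-linear map preserving the $\lambda$-bracket; the conjugate of $R$ by $\psi$ is $\psi^{-1}R\psi$. A Rota--Baxter operator of weight $0$ on $L$ is a $\mathbb{C}[\partial]$-linear map $R:L\to L$ with $[R(a)_\lambda R(b)] = R([R(a)_\lambda b]+[a_\lambda R(b)])$ for all $a,b\in L$, where $R$ acts coefficientwise in $\lambda$. The $\partial$-linear extension of a linear map $P:\mathfrak{g}\to\mathfrak{g}$ to $\mathrm{Cur}(\mathfrak{g})$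 is $f(\partial)a\mapsto f(\partial)P(a)$. On tensor powers of $L$ (over $\mathbb{C}$), $\partial_{\otimes i}$ denotes $\partial$ acting on the $i$-th tensor factor, and $\partial^{\otimes 3}=\partial_{\otimes 1}+\partial_{\otimes 2}+\partial_{\otimes 3}$ on $L^{\otimes 3}$. For $r=\sum_i a_i\otimes b_i\in L\otimes L$, the conformal classical Yang--Baxter equation (CCYBE) is the equation in $L^{\otimes 3}$ modulo the image of $\partial^{\otimes 3}$: $$\sum_{i,j}\Big([{a_i}_\lambda a_j]\otimes b_i\otimes b_j\big|_{\lambda=\partial_{\otimes 2}} - a_i\otimes[{a_j}_\lambda b_i]\otimes b_j\big|_{\lambda=\partial_{\otimes 3}} - a_i\otimes a_j\otimes[{b_j}_\lambda b_i]\big|_{\lambda=\partial_{\otimes 2}}\Big)=0 \pmod{\partial^{\otimes 3}}.$$ The element $r$ is skew-symmetric if $r+\tau(r)=0$, where $\tau(a\otimes b)=b\otimes a$. For a skew-symmetric solution $r$ of the CCYBE on $L$, the map $P^r_0$ defined in the claim is known to be a Rota--Baxter operator of weight $0$ on $L$. *)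

theory Defs
  imports "HOL-Analysis.Analysis" "HOL-Computational_Algebra.Polynomial"
begin

section \<open>Lie algebras with a fixed finite basis\<close>

text \<open>
  A Lie algebra over the complex numbers with a fixed basis indexed by a finite type is given
  by its coordinate space and a bracket \<open>br\<close>; the basis vectors are \<open>axis i 1\<close>.
\<close>

definition killing_form ::
  "(complex^'n \<Rightarrow> complex^'n \<Rightarrow> complex^'n) \<Rightarrow> complex^'n \<Rightarrow> complex^'n \<Rightarrow> complex" where
  "killing_form br x y = trace (matrix (\<lambda>z. br x (br y z)))"

definition rota_baxter ::
  "(complex^'n \<Rightarrow> complex^'n \<Rightarrow> complex^'n) \<Rightarrow> (complex^'n \<Rightarrow> complex^'n) \<Rightarrow> bool" where
  "rota_baxter br R \<longleftrightarrow>
     Vector_Spaces.linear (*s) (*s) R \<and>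
     (\<forall>a b. br (R a) (R b) = R (br (R a) b + br a (R b)))"

text \<open>The coordinates of an element of \<open>sl\<^sub>2\<close> refer to the basis \<open>e, f, h\<close>, in this order.\<close>

definition sl2_bracket :: "complex^3 \<Rightarrow> complex^3 \<Rightarrow> complex^3" where
  "sl2_bracket x y = vector
     [2 * (x$3 * y$1 - x$1 * y$3),
      2 * (x$2 * y$3 - x$3 * y$2),
      x$1 * y$2 - x$2 * y$1]"

lemma sl2_bracket_basis:
  "sl2_bracket (axis 1 1) (axis 2 1) = axis 3 1"
  "sl2_bracket (axis 3 1) (axis 1 1) = 2 *s axis 1 1"
  "sl2_bracket (axis 3 1) (axis 2 1) = (-2) *s axis 2 1"
  by (simp_all add: sl2_bracket_def vec_eq_iff forall_3 axis_def)

definition sl2_matrix :: "complex^3 \<Rightarrow> complex^2^2" where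
  "sl2_matrix x = vector [vector [x$3, x$1], vector [x$2, - x$3]]"

lemma sl2_matrix_bracket:
  "sl2_matrix (sl2_bracket x y) =
     sl2_matrix x ** sl2_matrix y - sl2_matrix y ** sl2_matrix x"
  by (simp add: sl2_matrix_def sl2_bracket_def vec_eq_iff forall_2 matrix_matrix_mult_def
      sum_2 algebra_simps)

lemma bij_betw_sl2_matrix: "bij_betw sl2_matrix UNIV {A. trace A = 0}"
proof (rule bij_betw_byWitness[where f' = "\<lambda>A. vector [A$1$2, A$2$1, A$1$1]"])
  show "\<forall>A\<in>{A. trace A = 0}. sl2_matrix (vector [A$1$2, A$2$1, A$1$1]) = A"
    by (auto simp: sl2_matrix_def vec_eq_iff forall_2 trace_def sum_2 add_eq_0_iff)
qed (auto simp: sl2_matrix_def vec_eq_iff forall_3 trace_def sum_2)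


section \<open>Polynomials in several variables\<close>

text \<open>
  Polynomials in two or three variables are nested univariate polynomials: the innermost
  variable is the first one.
\<close>

definition subst_poly :: "(complex \<Rightarrow> 'a::comm_ring_1) \<Rightarrow> complex poly \<Rightarrow> 'a \<Rightarrow> 'a" where
  "subst_poly emb p X = poly (map_poly emb p) X"

definition subst_poly2 ::
  "(complex \<Rightarrow> 'a::comm_ring_1) \<Rightarrow> complex poly poly \<Rightarrow> 'a \<Rightarrow> 'a \<Rightarrow> 'a" where
  "subst_poly2 emb A X Y = poly (map_poly (\<lambda>p. subst_poly emb p X) A) Y"

abbreviation const1 :: "complex \<Rightarrow> complex poly" where "const1 c \<equiv> [:c:]"
abbreviation const2 :: "complex \<Rightarrow> complex poly poly" where "const2 c \<equiv> [:[:c:]:]"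
abbreviation const3 :: "complex \<Rightarrow> complex poly poly poly" where "const3 c \<equiv> [:[:[:c:]:]:]"

abbreviation var2_1 :: "complex poly poly" where "var2_1 \<equiv> [:[:0, 1:]:]"
abbreviation var2_2 :: "complex poly poly" where "var2_2 \<equiv> [:0, 1:]"

abbreviation var3_1 :: "complex poly poly poly" where "var3_1 \<equiv> [:[:[:0, 1:]:]:]"
abbreviation var3_2 :: "complex poly poly poly" where "var3_2 \<equiv> [:[:0, 1:]:]"
abbreviation var3_3 :: "complex poly poly poly" where "var3_3 \<equiv> [:0, 1:]"

definition odd_poly :: "complex poly \<Rightarrow> bool" where
  "odd_poly q \<longleftrightarrow> q \<circ>\<^sub>p [:0, -1:] = - q"


section \<open>Current Lie conformal algebras\<close>

text \<open>
  The free module \<open>\<complex>[\<partial>] \<otimes> \<gg>\<close> consists of coordinate vectors with entries in \<open>\<complex>[\<partial>]\<close>, with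
  \<open>(*s)\<close> as the action of \<open>\<complex>[\<partial>]\<close>.
\<close>

type_synonym 'n cur = "complex poly^'n"

definition cur_const :: "complex^'n \<Rightarrow> 'n cur" where
  "cur_const u = (\<chi> i. [:u$i:])"

abbreviation cur_linear :: "('n::finite cur \<Rightarrow> 'n cur) \<Rightarrow> bool" where
  "cur_linear \<equiv> module_hom (*s) (*s)"

definition cur_extension :: "(complex^'n \<Rightarrow> 'n cur) \<Rightarrow> 'n cur \<Rightarrow> 'n cur" where
  "cur_extension \<phi> x = (\<Sum>i\<in>UNIV. x$i *s \<phi> (axis i 1))"

text \<open>
  Values of the \<open>\<lambda>\<close>-bracket are polynomials in \<open>\<lambda>\<close> with coefficients in \<open>\<complex>[\<partial>] \<otimes> \<gg>\<close>. In the
  scalar factors, which lie in \<open>\<complex>[\<partial>][\<lambda>]\<close>, the variable \<open>\<partial>\<close> is \<open>var2_1\<close> and \<open>\<lambda>\<close> is \<open>var2_2\<close>.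
\<close>

definition lambda_bracket ::
  "(complex^'n \<Rightarrow> complex^'n \<Rightarrow> complex^'n) \<Rightarrow> 'n cur \<Rightarrow> 'n cur \<Rightarrow> 'n cur poly" where
  "lambda_bracket br x y =
     (\<Sum>i\<in>UNIV. \<Sum>j\<in>UNIV.
        map_poly (\<lambda>c. c *s cur_const (br (axis i 1) (axis j 1)))
          (subst_poly const2 (x$i) (- var2_2) * subst_poly const2 (y$j) (var2_2 + var2_1)))"

definition cur_automorphism ::
  "(complex^'n \<Rightarrow> complex^'n \<Rightarrow> complex^'n) \<Rightarrow> ('n cur \<Rightarrow> 'n cur) \<Rightarrow> bool" where
  "cur_automorphism br \<psi> \<longleftrightarrow>
     cur_linear \<psi> \<and> bij \<psi> \<and>
     (\<forall>x y. lambda_bracket br (\<psi> x) (\<psi> y) = map_poly \<psi> (lambda_bracket br x y))"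

definition conjugate :: "('n::finite cur \<Rightarrow> 'n cur) \<Rightarrow> ('n cur \<Rightarrow> 'n cur) \<Rightarrow> 'n cur \<Rightarrow> 'n cur" where
  "conjugate \<psi> R = inv \<psi> \<circ> R \<circ> \<psi>"


section \<open>The conformal classical Yang--Baxter equation\<close>

text \<open>
  An element \<open>r\<close> of the tensor square is given by its coefficients \<open>r$i$j\<close>, polynomials in
  \<open>\<partial>\<^sub>\<otimes>\<^sub>1, \<partial>\<^sub>\<otimes>\<^sub>2\<close>, at \<open>i \<otimes> j\<close>; similarly for the tensor cube.
\<close>

type_synonym 'n cur2 = "complex poly poly^'n^'n"
type_synonym 'n cur3 = "complex poly poly poly^'n^'n^'n"

definition tensor2 :: "'n::finite cur \<Rightarrow> 'n cur \<Rightarrow> 'n cur2" where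
  "tensor2 a b =
     (\<chi> i j. subst_poly const2 (a$i) var2_1 * subst_poly const2 (b$j) var2_2)"

definition tensor3 :: "'n::finite cur \<Rightarrow> 'n cur \<Rightarrow> 'n cur \<Rightarrow> 'n cur3" where
  "tensor3 a b c =
     (\<chi> i j k. subst_poly const3 (a$i) var3_1 * subst_poly const3 (b$j) var3_2
               * subst_poly const3 (c$k) var3_3)"

definition scale3 :: "complex poly poly poly \<Rightarrow> 'n::finite cur3 \<Rightarrow> 'n cur3" where
  "scale3 p t = (\<chi> i j k. p * t$i$j$k)"

definition flip :: "'n::finite cur2 \<Rightarrow> 'n cur2" where
  "flip r = (\<chi> i j. subst_poly2 const2 (r$j$i) var2_2 var2_1)"

definition skew_symmetric :: "'n::finite cur2 \<Rightarrow> bool" where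
  "skew_symmetric r \<longleftrightarrow> r + flip r = 0"

text \<open>
  If \<open>P\<close> is a polynomial in \<open>\<lambda>\<close> and \<open>T\<close> places an element of \<open>\<complex>[\<partial>] \<otimes> \<gg>\<close> into a slot of a tensor,
  then \<open>tensor_at D P T\<close> is the tensor with \<open>P\<close> in that slot, evaluated at \<open>\<lambda> = D\<close>.
\<close>

definition tensor_at ::
  "complex poly poly poly \<Rightarrow> 'n::finite cur poly \<Rightarrow> ('n cur \<Rightarrow> 'n cur3) \<Rightarrow> 'n cur3" where
  "tensor_at D P T = (\<Sum>m\<le>degree P. scale3 (D ^ m) (T (coeff P m)))"

text \<open>The list \<open>ts\<close> of pairs \<open>(a\<^sub>i, b\<^sub>i)\<close> stands for the tensor \<open>\<Sum>\<^sub>i a\<^sub>i \<otimes> b\<^sub>i\<close>.\<close>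

definition ccybe_lhs ::
  "(complex^'n \<Rightarrow> complex^'n \<Rightarrow> complex^'n) \<Rightarrow> ('n cur \<times> 'n cur) list \<Rightarrow> 'n cur3" where
  "ccybe_lhs br ts =
     (\<Sum>(ai, bi)\<leftarrow>ts. \<Sum>(aj, bj)\<leftarrow>ts.
          tensor_at var3_2 (lambda_bracket br ai aj) (\<lambda>x. tensor3 x bi bj)
        - tensor_at var3_3 (lambda_bracket br aj bi) (\<lambda>x. tensor3 ai x bj)
        - tensor_at var3_2 (lambda_bracket br bj bi) (\<lambda>x. tensor3 ai aj x))"

text \<open>
  The left-hand side is quadratic in the tensor and does not depend on its decomposition
  into pure tensors, so that any decomposition may be chosen.
\<close>

definition ccybe_solution ::
  "(complex^'n \<Rightarrow> complex^'n \<Rightarrow> complex^'n) \<Rightarrow> 'n cur2 \<Rightarrow> bool" where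
  "ccybe_solution br r \<longleftrightarrow>
     (\<exists>ts. r = (\<Sum>(a, b)\<leftarrow>ts. tensor2 a b) \<and>
           ccybe_lhs br ts \<in> range (scale3 (var3_1 + var3_2 + var3_3)))"

text \<open>The coefficients are evaluated at \<open>\<partial>\<^sub>\<otimes>\<^sub>1 = -\<partial>\<close> and \<open>\<partial>\<^sub>\<otimes>\<^sub>2 = \<partial>\<close>.\<close>

definition P0 ::
  "(complex^'n \<Rightarrow> complex^'n \<Rightarrow> complex^'n) \<Rightarrow> 'n cur2 \<Rightarrow> 'n cur \<Rightarrow> 'n cur" where
  "P0 br r = cur_extension (\<lambda>u. \<Sum>i\<in>UNIV. \<Sum>j\<in>UNIV.
     (subst_poly2 const1 (r$i$j) (- [:0, 1:]) [:0, 1:] * [:killing_form br (axis i 1) u:])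
       *s axis j 1)"


section \<open>The operators on the current algebra of \<open>sl\<^sub>2\<close>\<close>

abbreviation cur_e :: "3 cur" where "cur_e \<equiv> axis 1 1"
abbreviation cur_f :: "3 cur" where "cur_f \<equiv> axis 2 1"
abbreviation cur_h :: "3 cur" where "cur_h \<equiv> axis 3 1"

definition R1_operator :: "complex poly \<Rightarrow> complex \<Rightarrow> (3 cur \<Rightarrow> 3 cur) \<Rightarrow> bool" where
  "R1_operator q \<alpha> R \<longleftrightarrow>
     cur_linear R \<and> R cur_e = 0 \<and> R cur_f = q *s cur_e + [:\<alpha>:] *s cur_h \<and>
     R cur_h = [:-2 * \<alpha>:] *s cur_e"

definition R2_operator :: "complex poly \<Rightarrow> (3 cur \<Rightarrow> 3 cur) \<Rightarrow> bool" where
  "R2_operator q R \<longleftrightarrow>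
     cur_linear R \<and> R cur_e = 0 \<and> R cur_f = 0 \<and> R cur_h = q *s cur_h"

end

theory Submission
  imports Defs
begin

text \<open>
  Write \<open>\<rho> t\<close> for the operator on \<open>sl\<^sub>2\<close> obtained from \<open>R = P\<^sub>0\<^sup>r\<close> by evaluating \<open>\<partial> = t\<close>, and \<open>kf\<close>
  for the Killing form. Working modulo the total derivation means evaluating at points with
  \<open>x + y + z = 0\<close>, and there the CCYBE involves only the antidiagonal values \<open>A\<^sub>i\<^sub>j(-t, t)\<close> of the
  coefficients. So a skew-symmetric solution amounts to a polynomial family \<open>\<rho>\<close> (locale
  \<open>cybe_operator\<close>) such that \<open>- \<rho> (- t)\<close> is the adjoint of \<open>\<rho> t\<close> and

    \<open>kf a [\<rho> y b, \<rho> z c] + kf b [\<rho> z c, \<rho> x a] + kf c [\<rho> x a, \<rho> y b] = 0\<close>  for \<open>x + y + z = 0\<close>.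

  The operator \<open>\<rho> 0\<close> is skew-adjoint, hence equal to \<open>[k, \<cdot>]\<close>, and \<open>k\<close> is nilpotent. Put \<open>y = 0\<close>.

  If \<open>k = 0\<close>, the values of \<open>\<rho> (- t)\<close> and \<open>\<rho> t\<close> commute, that is, are parallel, so \<open>\<rho> t\<close> is
  self-adjoint of rank one. The identity for general \<open>y\<close> forces the line of its values to be independent
  of \<open>t\<close>: if not, vectors from these lines would be pairwise orthogonal, and a totally isotropic
  subspace of \<open>sl\<^sub>2\<close> is at most a line. So \<open>\<rho> t u = p(t) kf n u n\<close> with a constant \<open>n\<close>
  (\<open>classify_zero\<close>).

  If \<open>k \<noteq> 0\<close>, the identity determines the coefficients of \<open>\<rho>\<close> degree by degree: each coefficient of
  positive degree is a multiple of \<open>kf k u k\<close>, since the brackets of lower ones vanish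
  (\<open>coeff_rank_one\<close>). So \<open>\<rho> t u = [k, u] + p(t) kf k u k\<close>.

  Both cases give \<open>normal_form\<close>, where \<open>p\<close> is odd. An inner automorphism moves \<open>n\<close> to a multiple of
  \<open>e\<close> or \<open>h\<close> (\<open>Ad_orbit\<close>). For \<open>p \<noteq> 0\<close> this gives (R1) and (R2); for \<open>p = 0\<close> the operator is
  \<open>[k, \<cdot>]\<close> with \<open>k\<close> nilpotent, a Rota--Baxter operator. Conversely, a solution for a given (R1) or
  (R2) can be written down (\<open>realisation\<close>), with the identity as automorphism.
\<close>

section \<open>Evaluating nested polynomials\<close>

definition ev2 :: "complex poly poly \<Rightarrow> complex \<Rightarrow> complex \<Rightarrow> complex" where
  "ev2 A x y = poly (poly A [:y:]) x"

definition ev3 :: "complex poly poly poly \<Rightarrow> complex \<Rightarrow> complex \<Rightarrow> complex \<Rightarrow> complex" where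
  "ev3 T x y z = ev2 (poly T [:[:z:]:]) x y"

lemma ev2_simps [simp]:
  "ev2 0 x y = 0" "ev2 1 x y = 1" "ev2 (A + B) x y = ev2 A x y + ev2 B x y"
  "ev2 (A - B) x y = ev2 A x y - ev2 B x y" "ev2 (- A) x y = - ev2 A x y"
  "ev2 (A * B) x y = ev2 A x y * ev2 B x y" "ev2 (A ^ n) x y = ev2 A x y ^ n"
  "ev2 [:a:] x y = poly a x" "ev2 var2_2 x y = y"
  by (simp_all add: ev2_def)

lemma ev3_simps [simp]:
  "ev3 0 x y z = 0" "ev3 1 x y z = 1" "ev3 (A + B) x y z = ev3 A x y z + ev3 B x y z"
  "ev3 (A - B) x y z = ev3 A x y z - ev3 B x y z" "ev3 (- A) x y z = - ev3 A x y z"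
  "ev3 (A * B) x y z = ev3 A x y z * ev3 B x y z" "ev3 (A ^ n) x y z = ev3 A x y z ^ n"
  "ev3 [:a:] x y z = ev2 a x y" "ev3 var3_3 x y z = z"
  by (simp_all add: ev3_def)

lemma ev3_sum: "ev3 (sum F S) x y z = (\<Sum>i\<in>S. ev3 (F i) x y z)"
  by (induction S rule: infinite_finite_induct) auto

lemma poly_ext: "(\<And>t. poly p t = poly q t) \<Longrightarrow> p = q" for p q :: "complex poly"
  using poly_eq_poly_eq_iff by blast

text \<open>
  For a fixed value of the outer variable a polynomial with zero values vanishes identically in the
  inner one, so the outer polynomial has the infinitely many constants among its roots.
\<close>

lemma ev2_eqI:
  assumes "\<And>x y. ev2 A x y = ev2 B x y"
  shows "A = B"
proof -
  define C where "C = A - B"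
  have ev: "ev2 C x y = 0" for x y using assms by (simp add: C_def)
  have "poly C [:y:] = 0" for y
    by (rule poly_ext) (use ev in \<open>simp add: ev2_def\<close>)
  then have "range (\<lambda>y. [:y:]) \<subseteq> {c. poly C c = 0}" by auto
  moreover have "infinite (range (\<lambda>y::complex. [:y:]))"
    by (simp add: finite_image_iff inj_on_def infinite_UNIV_char_0)
  ultimately have "C = 0" using poly_roots_finite finite_subset by blast
  then show ?thesis by (simp add: C_def)
qed

lemma subst_poly_simps [simp]:
  assumes "emb 0 = 0"
  shows "subst_poly emb 0 X = 0"
        "subst_poly emb (pCons c p) X = emb c + X * subst_poly emb p X"
  using assms by (simp_all add: subst_poly_def map_poly_pCons)

lemma subst_poly2_simps [simp]:
  assumes "emb 0 = 0"
  shows "subst_poly2 emb 0 X Y = 0"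
        "subst_poly2 emb (pCons c A) X Y = subst_poly emb c X + Y * subst_poly2 emb A X Y"
  using assms by (simp_all add: subst_poly2_def map_poly_pCons)

lemma ev2_subst_poly [simp]: "ev2 (subst_poly const2 p X) x y = poly p (ev2 X x y)"
  by (induction p) auto

lemma ev3_subst_poly [simp]: "ev3 (subst_poly const3 p X) x y z = poly p (ev3 X x y z)"
  by (induction p) auto

lemma poly_subst_poly [simp]: "poly (subst_poly const1 p X) t = poly p (poly X t)"
  by (induction p) auto

lemma ev2_pCons: "ev2 (pCons a A) x y = poly a x + y * ev2 A x y"
  by (simp add: ev2_def)

lemma ev3_pCons: "ev3 (pCons a T) x y z = ev2 a x y + z * ev3 T x y z"
  by (simp add: ev3_def ev2_def)

lemma ev2_subst_poly2 [simp]: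
  "ev2 (subst_poly2 const2 A X Y) x y = ev2 A (ev2 X x y) (ev2 Y x y)"
  by (induction A) (auto simp: ev2_pCons)

lemma poly_subst_poly2 [simp]:
  "poly (subst_poly2 const1 A X Y) t = ev2 A (poly X t) (poly Y t)"
  by (induction A) (auto simp: ev2_pCons)

lemma ev2_tensor2 [simp]: "ev2 (tensor2 a b $ i $ j) x y = poly (a $ i) x * poly (b $ j) y"
  by (simp add: tensor2_def)

lemma ev3_tensor3 [simp]:
  "ev3 (tensor3 a b c $ i $ j $ k) x y z = poly (a $ i) x * poly (b $ j) y * poly (c $ k) z"
  by (simp add: tensor3_def)

lemma ev3_scale3 [simp]: "ev3 (scale3 p t $ i $ j $ k) x y z = ev3 p x y z * ev3 (t $ i $ j $ k) x y z"
  by (simp add: scale3_def)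

lemma skew_symmetric_iff:
  "skew_symmetric r \<longleftrightarrow> (\<forall>i j x y. ev2 (r $ i $ j) x y = - ev2 (r $ j $ i) y x)"
proof -
  have "skew_symmetric r \<longleftrightarrow> (\<forall>i j. r $ i $ j + subst_poly2 const2 (r $ j $ i) var2_2 var2_1 = 0)"
    by (simp add: skew_symmetric_def flip_def vec_eq_iff)
  also have "\<dots> \<longleftrightarrow> (\<forall>i j x y. ev2 (r $ i $ j + subst_poly2 const2 (r $ j $ i) var2_2 var2_1) x y = 0)"
    by (metis ev2_eqI ev2_simps(1))
  finally show ?thesis by (simp add: eq_neg_iff_add_eq_0)
qed

text \<open>
  The sum of the three variables is monic of degree one in the last of them, so it divides a
  polynomial exactly if substituting \<open>- x - y\<close> for that variable gives zero; and over an infinite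
  field the latter can be tested on values.
\<close>

lemma range_scale3_iff:
  "(t :: 'n::finite cur3) \<in> range (scale3 (var3_1 + var3_2 + var3_3)) \<longleftrightarrow>
     (\<forall>a b c x y z. x + y + z = 0 \<longrightarrow> ev3 (t $ a $ b $ c) x y z = 0)"
    (is "_ \<longleftrightarrow> ?R")
proof
  assume "t \<in> range (scale3 (var3_1 + var3_2 + var3_3))"
  then show ?R by (auto simp del: add_pCons)
next
  assume R: ?R
  let ?S = "var3_1 + var3_2 + var3_3 :: complex poly poly poly"
  have S: "?S = [: - (- var2_1 - var2_2), 1:]" by simp
  have "?S dvd t $ a $ b $ c" for a b c
  proof -
    have "poly (t $ a $ b $ c) (- var2_1 - var2_2) = 0"
    proof (rule ev2_eqI)
      fix x y
      have "ev2 (poly T (- var2_1 - var2_2)) x y = ev3 T x y (- x - y)" for T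
        by (induction T) (auto simp: ev3_pCons simp del: diff_pCons minus_pCons)
      then show "ev2 (poly (t $ a $ b $ c) (- var2_1 - var2_2)) x y = ev2 0 x y"
        using R by simp
    qed
    then show ?thesis unfolding S by (simp only: poly_eq_0_iff_dvd)
  qed
  then have "\<forall>a b c. \<exists>q. t $ a $ b $ c = ?S * q" by (simp only: dvd_def) blast
  then obtain Q where "\<And>a b c. t $ a $ b $ c = ?S * Q a b c" by metis
  then have "t = scale3 ?S (\<chi> a b c. Q a b c)"
    unfolding scale3_def vec_eq_iff by simp
  then show "t \<in> range (scale3 ?S)" by blast
qed

section \<open>The Yang--Baxter equation in evaluated form\<close>

text \<open>
  Here \<open>d\<close> is the value of \<open>\<lambda>\<close> and \<open>x\<close> the value of \<open>\<partial>\<close>. The coefficients lie in a module that is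
  not a ring, so \<open>poly\<close> does not apply to them.
\<close>

definition lambda_ev :: "'n cur poly \<Rightarrow> 'n::finite \<Rightarrow> complex \<Rightarrow> complex \<Rightarrow> complex" where
  "lambda_ev P a d x = (\<Sum>m\<le>degree P. d ^ m * poly (coeff P m $ a) x)"

lemma lambda_ev_alt:
  assumes "degree P \<le> N"
  shows "lambda_ev P a d x = (\<Sum>m\<le>N. d ^ m * poly (coeff P m $ a) x)"
  unfolding lambda_ev_def
  by (rule sum.mono_neutral_left) (use assms in \<open>auto simp: coeff_eq_0\<close>)

lemma lambda_ev_0 [simp]: "lambda_ev 0 a d x = 0"
  by (simp add: lambda_ev_def)

lemma lambda_ev_add: "lambda_ev (P + Q) a d x = lambda_ev P a d x + lambda_ev Q a d x"
proof -
  let ?N = "max (degree P) (degree Q)"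
  have "degree (P + Q) \<le> ?N" by (rule degree_add_le) auto
  then show ?thesis
    by (simp add: lambda_ev_alt[where N = ?N] ring_distribs sum.distrib)
qed

lemma lambda_ev_sum: "lambda_ev (sum F S) a d x = (\<Sum>i\<in>S. lambda_ev (F i) a d x)"
  by (induction S rule: infinite_finite_induct) (auto simp: lambda_ev_add)

lemma lambda_ev_map_poly:
  "lambda_ev (map_poly (\<lambda>c. c *s cur_const u) Q) a d x = ev2 Q x d * u $ a"
proof -
  have "lambda_ev (map_poly (\<lambda>c. c *s cur_const u) Q) a d x
      = (\<Sum>m\<le>degree Q. d ^ m * (poly (coeff Q m) x * u $ a))"
    by (subst lambda_ev_alt[OF map_poly_degree_leq])
       (simp_all add: coeff_map_poly cur_const_def mult.commute)
  also have "\<dots> = (\<Sum>m\<le>degree Q. poly (coeff Q m) x * d ^ m) * u $ a"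
    by (simp add: sum_distrib_left sum_distrib_right mult_ac)
  also have "(\<Sum>m\<le>degree Q. poly (coeff Q m) x * d ^ m) = ev2 Q x d"
    by (simp add: ev2_def poly_altdef[of Q] poly_sum)
  finally show ?thesis .
qed

lemma lambda_ev_bracket:
  "lambda_ev (lambda_bracket br u v) a d x =
     (\<Sum>i\<in>UNIV. \<Sum>j\<in>UNIV. poly (u $ i) (- d) * poly (v $ j) (d + x) * br (axis i 1) (axis j 1) $ a)"
  by (simp add: lambda_bracket_def lambda_ev_sum lambda_ev_map_poly del: add_pCons minus_pCons)

lemma ev3_tensor_at:
  assumes "\<And>w. ev3 (T w $ a $ b $ c) x y z = poly (w $ k) s * C"
  shows "ev3 (tensor_at D P T $ a $ b $ c) x y z = lambda_ev P k (ev3 D x y z) s * C"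
  by (simp add: tensor_at_def lambda_ev_def ev3_sum assms sum_distrib_right mult.assoc)

text \<open>
  The matrix \<open>A\<^sub>i\<^sub>j(-t, t)\<close>. Besides defining the operator, it is all of \<open>r\<close> that enters the
  equation modulo the sum of the derivations.
\<close>

definition antidiag_ev :: "'n::finite cur2 \<Rightarrow> complex \<Rightarrow> 'n \<Rightarrow> 'n \<Rightarrow> complex" where
  "antidiag_ev r t i j = ev2 (r $ i $ j) (- t) t"

lemma antidiag_ev_skew: "skew_symmetric r \<Longrightarrow> antidiag_ev r (- t) i j = - antidiag_ev r t j i"
  unfolding skew_symmetric_iff antidiag_ev_def by (metis add.inverse_inverse)

text \<open>
  With the antidiagonal values of \<open>r\<close> for \<open>M\<close>, this is the coefficient of the left-hand side of the
  CCYBE at the basis tensor \<open>a \<otimes> b \<otimes> c\<close>, evaluated at a point where the three derivations have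
  values \<open>x\<close>, \<open>y\<close>, \<open>z\<close> with sum zero.
\<close>

definition ccybe_ev ::
  "(complex^'n \<Rightarrow> complex^'n \<Rightarrow> complex^'n) \<Rightarrow> (complex \<Rightarrow> 'n \<Rightarrow> 'n \<Rightarrow> complex) \<Rightarrow>
   'n::finite \<Rightarrow> 'n \<Rightarrow> 'n \<Rightarrow> complex \<Rightarrow> complex \<Rightarrow> complex \<Rightarrow> complex" where
  "ccybe_ev br M a b c x y z =
     (\<Sum>k\<in>UNIV. \<Sum>l\<in>UNIV.
         br (axis k 1) (axis l 1) $ a * (M y k b * M z l c)
       - br (axis k 1) (axis l 1) $ b * (M (- x) a l * M z k c)
       - br (axis k 1) (axis l 1) $ c * (M (- x) a l * M (- y) b k))"

lemma vec_sum_list_nth: "(\<Sum>p\<leftarrow>ts. F p) $ i = (\<Sum>p\<leftarrow>ts. F p $ i)"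
  by (induction ts) auto

lemma ev3_sum_list: "ev3 (\<Sum>p\<leftarrow>ts. F p) x y z = (\<Sum>p\<leftarrow>ts. ev3 (F p) x y z)"
  by (induction ts) auto

lemma ev2_sum_list: "ev2 (\<Sum>p\<leftarrow>ts. F p) x y = (\<Sum>p\<leftarrow>ts. ev2 (F p) x y)"
  by (induction ts) auto

lemma sum_list_sum_swap:
  "(\<Sum>p\<leftarrow>ts. \<Sum>k\<in>S. F p k) = (\<Sum>k\<in>S. \<Sum>p\<leftarrow>ts. F p k :: complex)"
  by (induction ts) (auto simp: sum.distrib)

lemma sum_list_diff: "(\<Sum>p\<leftarrow>ts. F p - G p) = (\<Sum>p\<leftarrow>ts. F p) - (\<Sum>p\<leftarrow>ts. G p :: complex)"
  by (induction ts) auto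

text \<open>
  Sesquilinearity turns the bracket of two factors into arguments such as \<open>-y\<close> and \<open>y + x\<close>, and
  modulo the total derivation \<open>y + x = -z\<close>. So in every term each coefficient of \<open>r\<close> is evaluated
  on its antidiagonal.
\<close>

lemma ev3_ccybe_lhs:
  assumes r: "r = (\<Sum>(a, b)\<leftarrow>ts. tensor2 a b)" and xyz: "x + y + z = 0"
  shows "ev3 (ccybe_lhs br ts $ a $ b $ c) x y z = ccybe_ev br (antidiag_ev r) a b c x y z"
proof -
  have M: "antidiag_ev r t i j = (\<Sum>p\<leftarrow>ts. poly (fst p $ i) (- t) * poly (snd p $ j) t)" for t i j
    unfolding r antidiag_ev_def by (simp add: vec_sum_list_nth ev2_sum_list split_def)
  have s: "y + x = - z" "z + y = - x" "y + z = - x" using xyz by (auto simp: algebra_simps eq_neg_iff_add_eq_0)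
  have 1: "ev3 (tensor_at var3_2 (lambda_bracket br ai aj) (\<lambda>x. tensor3 x bi bj) $ a $ b $ c) x y z
     = (\<Sum>k\<in>UNIV. \<Sum>l\<in>UNIV. br (axis k 1) (axis l 1) $ a *
          ((poly (ai $ k) (- y) * poly (bi $ b) y) * (poly (aj $ l) (- z) * poly (bj $ c) z)))"
    for ai aj bi bj
    by (subst ev3_tensor_at[where k = a and s = x and C = "poly (bi $ b) y * poly (bj $ c) z"])
       (simp_all add: lambda_ev_bracket s sum_distrib_left sum_distrib_right mult_ac)
  have 2: "ev3 (tensor_at var3_3 (lambda_bracket br aj bi) (\<lambda>x. tensor3 ai x bj) $ a $ b $ c) x y z
     = (\<Sum>k\<in>UNIV. \<Sum>l\<in>UNIV. br (axis k 1) (axis l 1) $ b *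
          ((poly (ai $ a) x * poly (bi $ l) (- x)) * (poly (aj $ k) (- z) * poly (bj $ c) z)))"
    for ai aj bi bj
    by (subst ev3_tensor_at[where k = b and s = y and C = "poly (ai $ a) x * poly (bj $ c) z"])
       (simp_all add: lambda_ev_bracket s sum_distrib_left sum_distrib_right mult_ac)
  have 3: "ev3 (tensor_at var3_2 (lambda_bracket br bj bi) (\<lambda>x. tensor3 ai aj x) $ a $ b $ c) x y z
     = (\<Sum>k\<in>UNIV. \<Sum>l\<in>UNIV. br (axis k 1) (axis l 1) $ c *
          ((poly (ai $ a) x * poly (bi $ l) (- x)) * (poly (aj $ b) y * poly (bj $ k) (- y))))"
    for ai aj bi bj
    by (subst ev3_tensor_at[where k = c and s = z and C = "poly (ai $ a) x * poly (aj $ b) y"])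
       (simp_all add: lambda_ev_bracket s sum_distrib_left sum_distrib_right mult_ac)
  have P: "(\<Sum>p\<leftarrow>ts. \<Sum>q\<leftarrow>ts. \<Sum>k\<in>UNIV. \<Sum>l\<in>UNIV. B k l * (F p k l * G q k l))
     = (\<Sum>k\<in>UNIV. \<Sum>l\<in>UNIV. B k l * ((\<Sum>p\<leftarrow>ts. F p k l) * (\<Sum>q\<leftarrow>ts. G q k l)))"
    for B :: "'a \<Rightarrow> 'a \<Rightarrow> complex" and F G
    by (simp add: sum_list_sum_swap sum_list_const_mult sum_list_mult_const mult_ac)
  show ?thesis
    unfolding ccybe_ev_def M
    by (simp add: ccybe_lhs_def vec_sum_list_nth ev3_sum_list split_def 1 2 3 P
        sum_list_diff sum_subtractf)
qed

lemma ccybe_solution_imp: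
  assumes "ccybe_solution br r" "x + y + z = 0"
  shows "ccybe_ev br (antidiag_ev r) a b c x y z = 0"
proof -
  obtain ts where "r = (\<Sum>(a, b)\<leftarrow>ts. tensor2 a b)"
    "ccybe_lhs br ts \<in> range (scale3 (var3_1 + var3_2 + var3_3))"
    using assms(1) unfolding ccybe_solution_def by blast
  then show ?thesis unfolding range_scale3_iff using ev3_ccybe_lhs assms(2) by metis
qed

lemma ccybe_solutionI:
  assumes "r = (\<Sum>(a, b)\<leftarrow>ts. tensor2 a b)"
    and "\<And>a b c x y z. x + y + z = 0 \<Longrightarrow> ccybe_ev br (antidiag_ev r) a b c x y z = 0"
  shows "ccybe_solution br r"
  unfolding ccybe_solution_def range_scale3_iff using assms ev3_ccybe_lhs by metis

section \<open>The bracket and the Killing form\<close>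

abbreviation br :: "complex^3 \<Rightarrow> complex^3 \<Rightarrow> complex^3" where "br \<equiv> sl2_bracket"

abbreviation kf :: "complex^3 \<Rightarrow> complex^3 \<Rightarrow> complex" where "kf \<equiv> killing_form sl2_bracket"

lemma sl2_bracket_nth [simp]:
  "br x y $ 1 = 2 * (x$3 * y$1 - x$1 * y$3)"
  "br x y $ 2 = 2 * (x$2 * y$3 - x$3 * y$2)"
  "br x y $ 3 = x$1 * y$2 - x$2 * y$1"
  by (simp_all add: sl2_bracket_def)

lemma kf_eq: "kf x y = 8 * x$3 * y$3 + 4 * (x$1 * y$2 + x$2 * y$1)"
  by (simp add: killing_form_def trace_def matrix_def sum_3 axis_def algebra_simps)

lemma kf_eq_0: "kf x y = 0 \<longleftrightarrow> x$1 * y$2 + x$2 * y$1 = - 2 * (x$3 * y$3)"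
proof -
  have "kf x y = 4 * (x$1 * y$2 + x$2 * y$1 - - 2 * (x$3 * y$3))"
    by (simp add: kf_eq algebra_simps)
  then show ?thesis by (simp only: mult_eq_0_iff right_minus_eq) simp
qed

lemma kf_simps [simp]:
  "kf (x + y) z = kf x z + kf y z" "kf x (y + z) = kf x y + kf x z"
  "kf (x - y) z = kf x z - kf y z" "kf x (y - z) = kf x y - kf x z"
  "kf (- x) z = - kf x z" "kf x (- z) = - kf x z"
  "kf (c *s x) z = c * kf x z" "kf x (c *s z) = c * kf x z"
  "kf 0 z = 0" "kf x 0 = 0"
  by (simp_all add: kf_eq algebra_simps)

lemma br_simps [simp]:
  "br (x + y) z = br x z + br y z" "br x (y + z) = br x y + br x z"
  "br (x - y) z = br x z - br y z" "br x (y - z) = br x y - br x z"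
  "br (- x) z = - br x z" "br x (- z) = - br x z"
  "br (c *s x) z = c *s br x z" "br x (c *s z) = c *s br x z"
  "br 0 z = 0" "br x 0 = 0" "br x x = 0"
  by (simp_all add: vec_eq_iff forall_3 algebra_simps)

lemma kf_sym: "kf x y = kf y x"
  by (simp add: kf_eq algebra_simps)

lemma kf_invariant: "kf (br x y) z = kf x (br y z)"
  by (simp add: kf_eq algebra_simps)

lemma kf_br_self [simp]: "kf x (br y x) = 0" "kf x (br x y) = 0"
  by (simp_all add: kf_eq algebra_simps)

lemma kf_nondegenerate: "(\<And>y. kf x y = 0) \<Longrightarrow> x = 0"
  using kf_eq[of x "axis 1 1"] kf_eq[of x "axis 2 1"] kf_eq[of x "axis 3 1"]
  by (simp add: vec_eq_iff forall_3 axis_def)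

text \<open>
  The vector triple product: \<open>sl\<^sub>2\<close> is three-dimensional space with the cross product, up to
  scaling. This identity does most of the work below.
\<close>

lemma br_br: "2 *s br x (br y z) = kf x y *s z - kf x z *s y"
  by (simp add: vec_eq_iff forall_3 kf_eq algebra_simps)

lemma jacobi: "br x (br y z) = br (br x y) z + br y (br x z)"
  by (simp add: vec_eq_iff forall_3 algebra_simps)

lemma vec3_basis: "(u::complex^3) = u$1 *s axis 1 1 + u$2 *s axis 2 1 + u$3 *s axis 3 1"
  by (simp add: vec_eq_iff forall_3 axis_def)

lemma br_basis:
  "br (axis 1 1) (axis 2 1) = axis 3 1" "br (axis 2 1) (axis 1 1) = - axis 3 1"
  "br (axis 3 1) (axis 1 1) = 2 *s axis 1 1" "br (axis 1 1) (axis 3 1) = -2 *s axis 1 1"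
  "br (axis 3 1) (axis 2 1) = -2 *s axis 2 1" "br (axis 2 1) (axis 3 1) = 2 *s axis 2 1"
  by (simp_all add: vec_eq_iff forall_3 axis_def)

section \<open>The operator attached to a solution\<close>

definition pev :: "complex \<Rightarrow> 'n::finite cur \<Rightarrow> complex^'n" where
  "pev t V = (\<chi> i. poly (V $ i) t)"

lemma cur_ext: "(\<And>t. pev t V = pev t W) \<Longrightarrow> V = W"
  by (simp add: pev_def vec_eq_iff poly_ext)

definition val :: "('n::finite cur \<Rightarrow> 'n cur) \<Rightarrow> complex \<Rightarrow> complex^'n \<Rightarrow> complex^'n" where
  "val R t u = pev t (R (cur_const u))"

lemma val_P0: "val (P0 br r) t u = (\<chi> j. \<Sum>i\<in>UNIV. antidiag_ev r t i j * kf (axis i 1) u)"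
  by (simp add: val_def pev_def P0_def cur_extension_def cur_const_def antidiag_ev_def vec_eq_iff sum_3
      forall_3 axis_def kf_eq algebra_simps)

lemma cur_linear_extension: "cur_linear (cur_extension \<phi>)"
  unfolding cur_extension_def
  by unfold_locales (auto simp: vec_eq_iff sum.distrib sum_distrib_left algebra_simps)

text \<open>
  With the Killing form moving indices, skew-symmetry of \<open>r\<close> says that the adjoint of the operator
  at \<open>t\<close> is minus the operator at \<open>-t\<close>.
\<close>

lemma val_P0_skew:
  assumes "skew_symmetric r"
  shows "kf (val (P0 br r) t u) v = - kf u (val (P0 br r) (- t) v)"
proof -
  have E: "kf (val (P0 br r) s a) b =
      (\<Sum>i\<in>UNIV. \<Sum>j\<in>UNIV. antidiag_ev r s i j * kf (axis i 1) a * kf (axis j 1) b)" for s a b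
    by (simp add: val_P0 sum_3 kf_eq axis_def algebra_simps)
  show ?thesis
    unfolding E kf_sym[of u] antidiag_ev_skew[OF assms]
    by (subst sum.swap) (simp add: sum_negf mult_ac)
qed

text \<open>
  Contracting the three slots of the tensor equation with vectors \<open>a\<close>, \<open>b\<close>, \<open>c\<close> makes it
  cyclically symmetric. The arguments change sign since a contraction on the right-hand index of
  \<open>r\<close> yields the adjoint operator.
\<close>

lemma ccybe_ev_P0:
  assumes skew: "skew_symmetric r"
  shows "kf a (br (val (P0 br r) (- y) b) (val (P0 br r) (- z) c))
       + kf b (br (val (P0 br r) (- z) c) (val (P0 br r) (- x) a))
       + kf c (br (val (P0 br r) (- x) a) (val (P0 br r) (- y) b))
     = (\<Sum>i\<in>UNIV. \<Sum>j\<in>UNIV. \<Sum>k\<in>UNIV.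
          kf (axis i 1) a * kf (axis j 1) b * kf (axis k 1) c * ccybe_ev br (antidiag_ev r) i j k x y z)"
proof -
  have sk: "antidiag_ev r (- t) i j = - antidiag_ev r t j i" for t i j using antidiag_ev_skew[OF skew] .
  show ?thesis
    by (simp add: ccybe_ev_def sum_3 br_basis sk val_P0 kf_eq axis_def, simp add: algebra_simps)
qed

section \<open>Polynomial functions of one variable\<close>

definition polyfun :: "(complex \<Rightarrow> complex) \<Rightarrow> bool" where
  "polyfun f \<longleftrightarrow> (\<exists>p. \<forall>t. f t = poly p t)"

lemma polyfunI: "(\<And>t. f t = poly p t) \<Longrightarrow> polyfun f"
  unfolding polyfun_def by blast

lemma polyfun_const: "polyfun (\<lambda>t. c)"
  by (rule polyfunI[of _ "[:c:]"]) simp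

lemma polyfun_add: "polyfun f \<Longrightarrow> polyfun g \<Longrightarrow> polyfun (\<lambda>t. f t + g t)"
  unfolding polyfun_def by (metis poly_add)

lemma polyfun_diff: "polyfun f \<Longrightarrow> polyfun g \<Longrightarrow> polyfun (\<lambda>t. f t - g t)"
  unfolding polyfun_def by (metis poly_diff)

lemma polyfun_mult: "polyfun f \<Longrightarrow> polyfun g \<Longrightarrow> polyfun (\<lambda>t. f t * g t)"
  unfolding polyfun_def by (metis poly_mult)

lemmas polyfun_intros = polyfun_const polyfun_add polyfun_diff polyfun_mult

lemma polyfun_reflect:
  assumes "polyfun f"
  shows "polyfun (\<lambda>t. f (- y - t))"
proof -
  obtain p where "\<And>t. f t = poly p t" using assms unfolding polyfun_def by blast
  then show ?thesis by (intro polyfunI[of _ "pcompose p [:- y, -1:]"]) (simp add: poly_pcompose)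
qed

lemma polyfun_zero_on_infinite:
  assumes "polyfun f" "infinite S" "\<And>t. t \<in> S \<Longrightarrow> f t = 0"
  shows "f t = 0"
proof -
  obtain p where p: "\<And>t. f t = poly p t" using assms(1) unfolding polyfun_def by blast
  then have "S \<subseteq> {t. poly p t = 0}" using assms(3) by auto
  then have "p = 0" using poly_roots_finite finite_subset assms(2) by blast
  then show ?thesis using p by simp
qed

lemma polyfun_mult_eq_0:
  assumes "polyfun f" "polyfun g" "\<And>t. f t * g t = 0"
  shows "(\<forall>t. f t = 0) \<or> (\<forall>t. g t = 0)"
proof -
  have "infinite ({t. f t = 0} \<union> {t. g t = 0})"
    using assms(3) infinite_UNIV_char_0[where 'a = complex]
    by (metis (mono_tags, lifting) UNIV_eq_I UnI1 UnI2 mem_Collect_eq mult_eq_0_iff)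
  then show ?thesis
    using polyfun_zero_on_infinite[OF assms(1)] polyfun_zero_on_infinite[OF assms(2)]
    by (metis (mono_tags, lifting) finite_UnI mem_Collect_eq)
qed

section \<open>Skew-adjoint operators satisfying the Yang--Baxter identity\<close>

lemma cur_const_add: "cur_const (u + v) = cur_const u + cur_const v"
  and cur_const_scale: "cur_const (c *s u) = [:c:] *s cur_const u"
  by (simp_all add: cur_const_def vec_eq_iff)

text \<open>
  The family of operators \<open>val R t\<close> on \<open>sl\<^sub>2\<close>, polynomial in \<open>t\<close>, carries the whole content of a
  skew-symmetric solution.
\<close>

locale cybe_operator =
  fixes R :: "3 cur \<Rightarrow> 3 cur"
  assumes lin: "cur_linear R"
    and skew: "kf (val R t u) v = - kf u (val R (- t) v)"
    and cybe: "x + y + z = 0 \<Longrightarrow>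
       kf a (br (val R y b) (val R z c)) + kf b (br (val R z c) (val R x a))
     + kf c (br (val R x a) (val R y b)) = 0"

lemma cybe_operator_P0:
  assumes skew: "skew_symmetric r" and sol: "ccybe_solution br r"
  shows "cybe_operator (P0 br r)"
proof (rule cybe_operator.intro)
  show "cur_linear (P0 br r)" unfolding P0_def by (rule cur_linear_extension)
  show "kf (val (P0 br r) t u) v = - kf u (val (P0 br r) (- t) v)" for t u v
    by (rule val_P0_skew[OF skew])
  fix x y z :: complex and a b c
  assume xyz: "x + y + z = 0"
  have "- x + - y + - z = - (x + y + z)" by simp
  then have "- x + - y + - z = 0" unfolding xyz by simp
  then show "kf a (br (val (P0 br r) y b) (val (P0 br r) z c))
     + kf b (br (val (P0 br r) z c) (val (P0 br r) x a))
     + kf c (br (val (P0 br r) x a) (val (P0 br r) y b)) = 0"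
    using ccybe_ev_P0[OF skew, of a "- y" b "- z" c "- x"] ccybe_solution_imp[OF sol] by simp
qed

context cybe_operator
begin

abbreviation \<rho> :: "complex \<Rightarrow> complex^3 \<Rightarrow> complex^3" where "\<rho> \<equiv> val R"

lemma R_add: "R (x + y) = R x + R y" and R_scale: "R (c *s x) = c *s R x"
  using lin by (simp_all add: module_hom.add module_hom.scale)

lemma val_add [simp]: "\<rho> t (u + v) = \<rho> t u + \<rho> t v"
  and val_scale [simp]: "\<rho> t (c *s u) = c *s \<rho> t u"
  by (simp_all add: val_def pev_def cur_const_add cur_const_scale R_add R_scale vec_eq_iff)

lemma polyfun_val: "polyfun (\<lambda>t. \<rho> t u $ i)"
  by (rule polyfunI[of _ "R (cur_const u) $ i"]) (simp add: val_def pev_def)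

lemma polyfun_val': "polyfun (\<lambda>t. \<rho> (- y - t) u $ i)"
  by (rule polyfun_reflect[OF polyfun_val])

text \<open>
  At \<open>t = 0\<close> the operator is skew-adjoint for the Killing form, hence the adjoint action of some
  \<open>k\<close>. The Yang--Baxter identity at \<open>x = y = z = 0\<close> on the basis vectors is a multiple of
  \<open>kf k k = 0\<close>.
\<close>

lemma val_0_eq_br: obtains k where "\<And>u. \<rho> 0 u = br k u" "kf k k = 0"
proof -
  define E F H where "E = \<rho> 0 (axis 1 1)" and "F = \<rho> 0 (axis 2 1)" and "H = \<rho> 0 (axis 3 1)"
  \<comment> \<open>Read off from \<open>[k, e] = 2 k\<^sub>h e - k\<^sub>f h\<close> and \<open>[k, f] = - 2 k\<^sub>h f + k\<^sub>e h\<close>.\<close>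
  define k :: "complex^3" where "k = vector [F$3, - E$3, E$1 / 2]"
  have sk: "\<rho> 0 u $ 1 * v$2 + \<rho> 0 u $ 2 * v$1 + 2 * (\<rho> 0 u $ 3 * v$3)
    + (u$1 * \<rho> 0 v $ 2 + u$2 * \<rho> 0 v $ 1 + 2 * (u$3 * \<rho> 0 v $ 3)) = 0" (is "?A + ?B = 0") for u v
  proof -
    have "4 * (?A + ?B) = kf (\<rho> 0 u) v + kf u (\<rho> 0 v)"
      by (simp add: kf_eq algebra_simps)
    also have "\<dots> = 0" using skew[of 0 u v] by simp
    finally show ?thesis by (simp only: mult_eq_0_iff numeral_neq_zero simp_thms)
  qed
  have E: "E = br k (axis 1 1)" and F: "F = br k (axis 2 1)" and H: "H = br k (axis 3 1)"
    using sk[of "axis 1 1" "axis 1 1"] sk[of "axis 1 1" "axis 2 1"] sk[of "axis 1 1" "axis 3 1"]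
      sk[of "axis 2 1" "axis 2 1"] sk[of "axis 2 1" "axis 3 1"] sk[of "axis 3 1" "axis 3 1"]
    unfolding E_def[symmetric] F_def[symmetric] H_def[symmetric]
    by (simp_all add: axis_def k_def
        vec_eq_iff forall_3 eq_neg_iff_add_eq_0 field_simps)
  have k: "\<rho> 0 u = br k u" for u
    by (subst (1 2) vec3_basis[of u]) (simp add: E[unfolded E_def] F[unfolded F_def] H[unfolded H_def])
  have "- (k$1 * k$2) = k$3 * k$3"
    using cybe[of 0 0 0 "axis 1 1" "axis 2 1" "axis 3 1"]
    by (simp add: k kf_eq axis_def algebra_simps)
  then have "k$1 * k$2 = - (k$3 * k$3)" by (simp only: eq_neg_iff_add_eq_0 neg_eq_iff_add_eq_0)
  then have "kf k k = 0" by (simp add: kf_eq_0 mult.commute)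
  then show thesis using that k by blast
qed

end

section \<open>Operators with vanishing constant term\<close>

text \<open>
  A totally isotropic subspace of a nondegenerate three-dimensional quadratic space is at most a
  line.
\<close>

lemma isotropic_br:
  assumes "kf u u = 0" "kf v v = 0" "kf u v = 0"
  shows "br u v = 0"
proof -
  have u: "u$1 * u$2 = - (u$3 * u$3)" and v: "v$1 * v$2 = - (v$3 * v$3)"
    and uv: "u$1 * v$2 + u$2 * v$1 = - 2 * (u$3 * v$3)"
    using assms unfolding kf_eq_0 by (auto simp: mult.commute)
  have "(u$3 * v$1 - u$1 * v$3)^2 = 0" "(u$2 * v$3 - u$3 * v$2)^2 = 0" "(u$1 * v$2 - u$2 * v$1)^2 = 0"
    using u v uv by algebra+
  then show ?thesis by (simp add: vec_eq_iff forall_3)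
qed

context cybe_operator
begin

context
  assumes zero: "\<And>u. \<rho> 0 u = 0"
begin

lemma br_opposite: "br (\<rho> (- t) c) (\<rho> t a) = 0"
proof (rule kf_nondegenerate)
  show "kf (br (\<rho> (- t) c) (\<rho> t a)) b = 0" for b
    using cybe[of t 0 "- t" a b c] by (simp add: zero kf_sym)
qed

text \<open>
  All values of \<open>\<rho> t\<close> are parallel to all values of \<open>\<rho> (- t)\<close>, so the bilinear form
  \<open>kf (\<rho> t b) c\<close> has rank at most one. That \<open>b\<close> and \<open>c\<close> change sides records in addition that the
  two operators, adjoint to each other up to sign, share their image.
\<close>

lemma form_rank_one:
  "kf (\<rho> t b) c * kf (\<rho> t a) d = kf (\<rho> t a) b * kf (\<rho> t d) c"
proof -
  have "kf b (\<rho> (- t) c) *s \<rho> t a = kf b (\<rho> t a) *s \<rho> (- t) c"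
    using br_br[of b "\<rho> (- t) c" "\<rho> t a"] by (simp add: br_opposite)
  then have "kf (kf b (\<rho> (- t) c) *s \<rho> t a) d = kf (kf b (\<rho> t a) *s \<rho> (- t) c) d"
    by simp
  then show ?thesis
    using skew[of t b c] skew[of t d c] by (simp add: kf_sym)
qed

lemma form_square: "(kf (\<rho> t b) c)\<^sup>2 = kf (\<rho> t b) b * kf (\<rho> t c) c"
  using form_rank_one[of t b c b c] by (simp add: power2_eq_square)

text \<open>
  A form of rank one is a product of two linear functionals, which represent the image of \<open>\<rho> t\<close> and
  the image of its adjoint. As both images are the same line, the functionals are proportional.
\<close>

lemma form_sym: "kf (\<rho> t b) c = kf (\<rho> t c) b"
proof (cases "kf (\<rho> t b) b = 0")
  case True
  then show ?thesis using form_square[of t b c] form_square[of t c b] by simp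
next
  case False
  then show ?thesis using form_rank_one[of t c b b b] by simp
qed

lemma val_uminus: "\<rho> (- t) u = - \<rho> t u"
proof -
  have "kf (\<rho> (- t) u + \<rho> t u) v = 0" for v
    using skew[of t v u] form_sym[of t u v] by (simp add: kf_sym)
  then show ?thesis using kf_nondegenerate by (metis add_eq_0_iff add.commute)
qed

lemma br_val: "br (\<rho> t c) (\<rho> t a) = 0"
  using br_opposite[of t c a] by (simp add: val_uminus)

lemma val_rank_one: "kf b (\<rho> t b) *s \<rho> t a = kf (\<rho> t b) a *s \<rho> t b"
  using br_br[of b "\<rho> t b" "\<rho> t a"] form_sym[of t a b] by (simp add: br_val kf_sym)

text \<open>
  The form is \<open>w \<otimes> w\<close> with \<open>w\<close> depending on \<open>t\<close>; it remains to show that the line of \<open>w\<close>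
  is constant. Take \<open>v t = \<rho> t b0\<close> as a polynomial choice of \<open>w\<close>. Testing the Yang--Baxter identity with
  vectors orthogonal to \<open>v x\<close> shows that \<open>v x\<close> commutes with \<open>[v y, v z]\<close> whenever
  \<open>x + y + z = 0\<close>, first where \<open>\<beta> x \<noteq> 0\<close> and then, both being polynomial, everywhere. If the lines varied, the \<open>v\<close> would thus be pairwise orthogonal, and then span an
  isotropic subspace, that is, a line after all.
\<close>

lemma classify_zero: "\<exists>n p. n \<noteq> 0 \<and> (\<forall>t u. \<rho> t u = (poly p t * kf n u) *s n)"
proof (cases "\<forall>t b. kf b (\<rho> t b) = 0")
  case True
  then have "kf (\<rho> t b) c = 0" for t b c
    using form_square[of t b c] by (simp add: kf_sym)
  then have "\<rho> t b = 0" for t b by (rule kf_nondegenerate)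
  then show ?thesis
    by (intro exI[of _ "axis 1 1"] exI[of _ 0]) (simp add: axis_eq_0_iff)
next
  case False
  then obtain t0 b0 where t0: "kf b0 (\<rho> t0 b0) \<noteq> 0" by blast
  define v where "v t = \<rho> t b0" for t
  define \<beta> where "\<beta> t = kf b0 (v t)" for t
  have R: "\<beta> t *s \<rho> t a = kf (v t) a *s v t" for t a
    unfolding \<beta>_def v_def by (rule val_rank_one)
  have pv: "polyfun (\<lambda>t. v t $ i)" "polyfun (\<lambda>t. v (- y - t) $ i)" for i y
    unfolding v_def by (rule polyfun_val polyfun_val')+
  have p\<beta>: "polyfun \<beta>"
    unfolding \<beta>_def kf_eq by (intro polyfun_intros pv)
  have \<beta>0: "\<beta> t0 \<noteq> 0" using t0 by (simp add: \<beta>_def v_def)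
  have \<beta>1: "\<not> (\<forall>t. \<beta> t = 0)" using \<beta>0 by blast
  \<comment> \<open>\<open>a = [w, v x]\<close> is orthogonal to \<open>v x\<close>, so \<open>\<rho> x a = 0\<close> and two of the three terms vanish.\<close>
  have prod0: "\<beta> x * (kf (v x) (v y) * v (- y - x) $ i - kf (v x) (v (- y - x)) * v y $ i) = 0"
    for x y i
  proof -
    let ?z = "- y - x"
    have "\<beta> x * kf (br w (v x)) (br (v y) (v ?z)) = 0" for w
    proof -
      have "kf (v x) (br w (v x)) = 0" by simp
      then have "\<beta> x *s \<rho> x (br w (v x)) = 0" using R[of x "br w (v x)"] by simp
      then have "\<beta> x = 0 \<or> \<rho> x (br w (v x)) = 0" by simp
      then show ?thesis
        using cybe[of x y ?z "br w (v x)" b0 b0] by (auto simp: v_def[symmetric])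
    qed
    then have "kf (\<beta> x *s br (v x) (br (v y) (v ?z))) w = 0" for w
      using kf_invariant[of w "v x" "br (v y) (v ?z)"] by (metis kf_simps(8) kf_sym)
    then have "\<beta> x *s br (v x) (br (v y) (v ?z)) = 0" by (rule kf_nondegenerate)
    then have "\<beta> x *s (2 *s br (v x) (br (v y) (v ?z))) = 0" by auto
    then have "\<beta> x *s (kf (v x) (v y) *s v ?z - kf (v x) (v ?z) *s v y) = 0"
      unfolding br_br .
    from arg_cong[OF this, of "\<lambda>w. w $ i"] show ?thesis by simp
  qed
  have prod: "kf (v x) (v y) *s v (- y - x) = kf (v x) (v (- y - x)) *s v y" for x y
  proof -
    have "kf (v x) (v y) * v (- y - x) $ i - kf (v x) (v (- y - x)) * v y $ i = 0" for i
    proof -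
      have "(\<forall>x. \<beta> x = 0) \<or>
        (\<forall>x. kf (v x) (v y) * v (- y - x) $ i - kf (v x) (v (- y - x)) * v y $ i = 0)"
        unfolding kf_eq
        by (intro polyfun_mult_eq_0 polyfun_intros pv p\<beta>)
           (use prod0[of _ y] in \<open>auto simp: kf_eq\<close>)
      then show ?thesis using \<beta>1 by blast
    qed
    then show ?thesis by (simp add: vec_eq_iff)
  qed
  \<comment> \<open>Bracket with \<open>v y\<close>; for fixed \<open>y\<close> both factors are polynomial in \<open>x\<close>.\<close>
  have dich: "(\<forall>x. kf (v x) (v y) = 0) \<or> (\<forall>x. br (v y) (v x) = 0)" for y
  proof -
    have "(\<forall>x. kf (v x) (v y) = 0) \<or> (\<forall>x. br (v y) (v (- y - x)) $ i = 0)" for i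
    proof (rule polyfun_mult_eq_0)
      show "polyfun (\<lambda>x. kf (v x) (v y))" unfolding kf_eq by (intro polyfun_intros pv)
      show "polyfun (\<lambda>x. br (v y) (v (- y - x)) $ i)"
        using exhaust_3[of i] by (auto intro!: polyfun_intros pv)
      show "kf (v x) (v y) * br (v y) (v (- y - x)) $ i = 0" for x
        using arg_cong[OF prod[of x y], of "\<lambda>w. br (v y) w $ i"] by simp
    qed
    then have "br (v y) (v (- y - x)) = 0" if "\<not> (\<forall>x. kf (v x) (v y) = 0)" for x
      using that unfolding vec_eq_iff zero_index by blast
    from this[of "- y - x" for x] show ?thesis by auto
  qed
  have comm: "br (v y) (v x) = 0" for x y
  proof -
    have "{y. \<forall>x. kf (v x) (v y) = 0} \<union> {y. \<forall>x. br (v y) (v x) = 0} = UNIV" (is "?K \<union> ?B = _")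
      using dich by blast
    then have "infinite (?K \<union> ?B)" using infinite_UNIV_char_0[where 'a = complex] by metis
    then consider "infinite ?K" | "infinite ?B"
      unfolding finite_Un by blast
    then show ?thesis
    proof cases
      case 1
      have "kf (v x) (v y) = 0" for x y
        by (rule polyfun_zero_on_infinite[OF _ 1, of "\<lambda>y. kf (v x) (v y)"])
           (unfold kf_eq, auto intro!: polyfun_intros pv)
      then show ?thesis by (intro isotropic_br) auto
    next
      case 2
      have "br (v y) (v x) $ i = 0" for i
        by (rule polyfun_zero_on_infinite[OF _ 2, of "\<lambda>y. br (v y) (v x) $ i"])
           (use exhaust_3[of i] in \<open>auto intro!: polyfun_intros pv\<close>)
      then show ?thesis by (simp add: vec_eq_iff)
    qed
  qed
  define n where "n = v t0"
  have v: "\<beta> t0 *s v t = \<beta> t *s n" for t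
    using br_br[of b0 "v t0" "v t"] by (simp add: comm n_def \<beta>_def)
  obtain b where b: "\<And>t. \<beta> t = poly b t" using p\<beta> unfolding polyfun_def by blast
  let ?p = "smult (1 / (\<beta> t0)\<^sup>2) b"
  have eq: "\<rho> t u = (poly ?p t * kf n u) *s n" for t u
  proof -
    have "\<rho> t u $ i - poly ?p t * kf n u * n $ i = 0" for i
    proof -
      have "(\<forall>t. \<beta> t = 0) \<or> (\<forall>t. \<rho> t u $ i - poly ?p t * kf n u * n $ i = 0)"
      proof (rule polyfun_mult_eq_0[OF p\<beta>])
        show "polyfun (\<lambda>t. \<rho> t u $ i - poly ?p t * kf n u * n $ i)"
          by (intro polyfun_intros polyfun_val polyfunI[of "poly ?p" ?p] refl)
        fix t
        have vt: "v t = (\<beta> t / \<beta> t0) *s n" using v[of t] \<beta>0 by (simp add: vec_eq_iff field_simps)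
        have "\<beta> t * \<rho> t u $ i = kf (v t) u * v t $ i"
          using arg_cong[OF R[of t u], of "\<lambda>w. w $ i"] by simp
        also have "\<dots> = \<beta> t * (poly ?p t * kf n u * n $ i)"
          unfolding vt using b by (simp add: power2_eq_square)
        finally show "\<beta> t * (\<rho> t u $ i - poly ?p t * kf n u * n $ i) = 0"
          by (simp add: algebra_simps)
      qed
      then show ?thesis using \<beta>1 by blast
    qed
    then show ?thesis by (simp add: vec_eq_iff)
  qed
  have "n \<noteq> 0" using \<beta>0 by (auto simp: n_def \<beta>_def)
  then show ?thesis using eq by blast
qed

end

end

section \<open>Operators with nonzero constant term\<close>

text \<open>
  The bracket extended linearly over polynomials: comparing coefficients requires identities between
  polynomial vectors instead of their values.
\<close>

definition pbr :: "3 cur \<Rightarrow> 3 cur \<Rightarrow> 3 cur" where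
  "pbr x y = vector
     [smult 2 (x$3 * y$1 - x$1 * y$3), smult 2 (x$2 * y$3 - x$3 * y$2), x$1 * y$2 - x$2 * y$1]"

lemma pbr_nth [simp]:
  "pbr x y $ 1 = smult 2 (x$3 * y$1 - x$1 * y$3)"
  "pbr x y $ 2 = smult 2 (x$2 * y$3 - x$3 * y$2)"
  "pbr x y $ 3 = x$1 * y$2 - x$2 * y$1"
  by (simp_all add: pbr_def)

definition vcoeff :: "'n::finite cur \<Rightarrow> nat \<Rightarrow> complex^'n" where
  "vcoeff V n = (\<chi> i. coeff (V $ i) n)"

lemma cur_eqI_coeff: "(\<And>n. vcoeff V n = vcoeff W n) \<Longrightarrow> V = W"
  by (simp add: vcoeff_def vec_eq_iff poly_eq_iff)

lemma pev_simps [simp]: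
  "pev t 0 = 0" "pev t (V + W) = pev t V + pev t W" "pev t (cur_const u) = u"
  "pev t (p *s V) = poly p t *s pev t V" "pev t (pbr X Y) = br (pev t X) (pev t Y)"
  by (simp_all add: pev_def cur_const_def vec_eq_iff forall_3)

lemma vcoeff_simps [simp]:
  "vcoeff 0 n = 0" "vcoeff (V + W) n = vcoeff V n + vcoeff W n"
  "vcoeff (cur_const u) 0 = u" "vcoeff (cur_const u) (Suc m) = 0"
  "vcoeff (p *s cur_const u) n = coeff p n *s u"
  "vcoeff (pbr X (cur_const u)) n = br (vcoeff X n) u"
  "vcoeff (pbr (cur_const u) X) n = br u (vcoeff X n)"
  by (simp_all add: vcoeff_def cur_const_def vec_eq_iff forall_3 mult.commute)

lemma vcoeff_pbr: "vcoeff (pbr X Y) n = (\<Sum>i\<le>n. br (vcoeff X i) (vcoeff Y (n - i)))"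
  by (simp add: vec_eq_iff forall_3 coeff_mult vcoeff_def sum_distrib_left sum_subtractf
      right_diff_distrib)

definition reflect :: "'n::finite cur \<Rightarrow> 'n cur" where
  "reflect V = (\<chi> i. V $ i \<circ>\<^sub>p [:0, -1:])"

lemma pev_reflect [simp]: "pev t (reflect V) = pev (- t) V"
  by (simp add: pev_def reflect_def poly_pcompose)

lemma vcoeff_reflect [simp]: "vcoeff (reflect V) n = (- 1) ^ n *s vcoeff V n"
  by (simp add: vcoeff_def reflect_def coeff_pcompose_linear vec_eq_iff)

definition kf_poly :: "3 cur \<Rightarrow> complex^3 \<Rightarrow> complex poly" where
  "kf_poly V u = smult (8 * u$3) (V$3) + smult (4 * u$2) (V$1) + smult (4 * u$1) (V$2)"

lemma poly_kf_poly [simp]: "poly (kf_poly V u) t = kf (pev t V) u"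
  by (simp add: kf_poly_def kf_eq pev_def algebra_simps)

lemma coeff_kf_poly [simp]: "coeff (kf_poly V u) n = kf (vcoeff V n) u"
  by (simp add: kf_poly_def kf_eq vcoeff_def algebra_simps)

context cybe_operator
begin

abbreviation \<kappa> :: "nat \<Rightarrow> complex^3 \<Rightarrow> complex^3" where "\<kappa> n u \<equiv> vcoeff (R (cur_const u)) n"

lemma coeff_skew: "kf (\<kappa> n u) v = - ((- 1) ^ n * kf u (\<kappa> n v))"
proof -
  have "kf_poly (R (cur_const u)) v = - kf_poly (reflect (R (cur_const v))) u"
    by (rule poly_ext)
       (simp add: skew[unfolded val_def, of _ u v] kf_sym[of u])
  from arg_cong[OF this, of "\<lambda>p. coeff p n"] show ?thesis by (simp add: kf_sym[of u])
qed

context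
  fixes k assumes zero: "\<And>u. \<rho> 0 u = br k u" and k0: "k \<noteq> 0" and isotropic: "kf k k = 0"
begin

lemma coeff_0: "\<kappa> 0 u = br k u"
  using zero[of u] by (simp add: val_def pev_def vcoeff_def poly_0_coeff_0)

text \<open>
  The specialisation \<open>y = 0\<close>, where \<open>\<rho> 0\<close> is the bracket with \<open>k\<close>, as an identity between
  polynomials.
\<close>

lemma cybe_at_0:
  "pbr (pbr (reflect (R (cur_const c))) (cur_const a)) (cur_const k)
   + pbr (reflect (R (cur_const c))) (R (cur_const a))
   + pbr (pbr (cur_const c) (R (cur_const a))) (cur_const k) = 0" (is "?L = 0")
proof (rule cur_ext)
  fix t
  let ?u = "\<rho> t a" and ?w = "\<rho> (- t) c"
  have "kf (br (br ?w a) k + br ?w ?u + br (br c ?u) k) b = 0" for b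
  proof -
    have "kf (br (br ?w a) k) b = kf a (br (br k b) ?w)" "kf (br (br c ?u) k) b = kf c (br ?u (br k b))"
      by (simp_all add: kf_eq algebra_simps)
    then show ?thesis
      using cybe[of t 0 "- t" a b c] by (simp add: zero kf_sym[of _ b])
  qed
  then have "br (br ?w a) k + br ?w ?u + br (br c ?u) k = 0" by (rule kf_nondegenerate)
  then show "pev t ?L = pev t 0" by (simp add: val_def)
qed

text \<open>
  In degree \<open>n\<close> the quadratic term of the preceding identity contributes brackets of coefficients
  of degrees \<open>i\<close> and \<open>n - i\<close>. If all lower coefficients of positive degree have values in the line
  of \<open>k\<close>, only \<open>i = 0\<close> and \<open>i = n\<close> survive, and the Jacobi identity leaves a linear condition.
\<close>

lemma linear_constraint:
  assumes "n > 0"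
    and IH: "\<And>m u. 0 < m \<Longrightarrow> m < n \<Longrightarrow> \<exists>s. \<kappa> m u = s *s k"
  shows "(- 1) ^ n *s br a (br k (\<kappa> n c)) = br c (br k (\<kappa> n a))"
proof -
  define \<epsilon> :: complex where "\<epsilon> = (- 1) ^ n"
  have "(\<Sum>i\<le>n. br (((- 1) ^ i) *s \<kappa> i c) (\<kappa> (n - i) a)) =
        (\<Sum>i\<in>{0, n}. br (((- 1) ^ i) *s \<kappa> i c) (\<kappa> (n - i) a))"
  proof (rule sum.mono_neutral_right)
    show "\<forall>i\<in>{..n} - {0, n}. br (((- 1) ^ i) *s \<kappa> i c) (\<kappa> (n - i) a) = 0"
    proof
      fix i assume "i \<in> {..n} - {0, n}"
      then have "0 < i" "i < n" "0 < n - i" "n - i < n" by auto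
      then obtain s s' where "\<kappa> i c = s *s k" "\<kappa> (n - i) a = s' *s k" using IH by metis
      then show "br (((- 1) ^ i) *s \<kappa> i c) (\<kappa> (n - i) a) = 0" by simp
    qed
  qed auto
  also have "(\<Sum>i\<in>{0, n}. br (((- 1) ^ i) *s \<kappa> i c) (\<kappa> (n - i) a)) = br (br k c) (\<kappa> n a) + \<epsilon> *s br (\<kappa> n c) (br k a)"
    using \<open>n > 0\<close> by (simp add: coeff_0 \<epsilon>_def)
  finally have S: "vcoeff (pbr (reflect (R (cur_const c))) (R (cur_const a))) n =
      br (br k c) (\<kappa> n a) + \<epsilon> *s br (\<kappa> n c) (br k a)"
    by (simp add: vcoeff_pbr)
  have "\<epsilon> *s br (br (\<kappa> n c) a) k + (br (br k c) (\<kappa> n a) + \<epsilon> *s br (\<kappa> n c) (br k a))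
       + br (br c (\<kappa> n a)) k = 0"
    using arg_cong[OF cybe_at_0[of c a], of "\<lambda>V. vcoeff V n"]
    by (simp add: S \<epsilon>_def)
  moreover have "\<epsilon> *s br a (br k (\<kappa> n c)) - br c (br k (\<kappa> n a)) =
      \<epsilon> *s br (br (\<kappa> n c) a) k + (br (br k c) (\<kappa> n a) + \<epsilon> *s br (\<kappa> n c) (br k a))
       + br (br c (\<kappa> n a)) k"
    by (simp add: vec_eq_iff forall_3 algebra_simps)
  ultimately show ?thesis by (simp add: \<epsilon>_def)
qed

text \<open>
  In the triple product form of the linear condition, even degrees force the skew-adjoint
  coefficient to vanish, and odd degrees leave only multiples of \<open>kf k u *s k\<close>.
\<close>

lemma coeff_rank_one:
  assumes c0: "kf k c0 = 1" and "n > 0"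
  shows "\<kappa> n u = (kf (\<kappa> n c0) c0 * kf k u) *s k"
  using \<open>n > 0\<close>
proof (induction n arbitrary: u rule: less_induct)
  case (less n)
  define \<epsilon> :: complex where "\<epsilon> = (- 1) ^ n"
  have sk: "kf u (\<kappa> n v) = - \<epsilon> * kf v (\<kappa> n u)" for u v
    using coeff_skew[where n = n and u = v and v = u] by (simp add: \<epsilon>_def kf_sym)
  have main: "\<epsilon> *s (kf k a *s \<kappa> n c) - kf k c *s \<kappa> n a = (2 * \<epsilon> * kf a (\<kappa> n c)) *s k" for a c
  proof -
    have X: "\<epsilon> *s br a (br k (\<kappa> n c)) = br c (br k (\<kappa> n a))"
      unfolding \<epsilon>_def using less by (intro linear_constraint) blast+
    have "\<epsilon> *s (2 *s br a (br k (\<kappa> n c))) = 2 *s br c (br k (\<kappa> n a))"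
      using arg_cong[OF X, of "(*s) 2"] by (simp only: vector_smult_assoc mult.commute)
    then have "\<epsilon> *s (kf a k *s \<kappa> n c - kf a (\<kappa> n c) *s k) = kf c k *s \<kappa> n a - kf c (\<kappa> n a) *s k"
      unfolding br_br .
    then show ?thesis
      unfolding sk[of c a] kf_sym[of _ k] by (simp add: vec_eq_iff algebra_simps)
  qed
  consider "\<epsilon> = 1" | "\<epsilon> = - 1" by (cases "even n") (simp_all add: \<epsilon>_def)
  then show ?case
  proof cases
    case 1
    have self: "kf a (\<kappa> n a) = 0" for a using sk[of a a] 1 by simp
    have f: "\<kappa> n a = kf k a *s \<kappa> n c0 - (2 * kf a (\<kappa> n c0)) *s k" for a
      using main[of a c0] c0 1 by (simp add: algebra_simps)
    have prod: "kf k a * kf a (\<kappa> n c0) = 0" for a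
      using arg_cong[OF f[of a], of "kf a"] self[of a] by (simp add: kf_sym[of a k])
    have off: "kf a (\<kappa> n c0) = 0" if "kf k a \<noteq> 0" for a
      using prod[of a] that by simp
    have "kf a (\<kappa> n c0) = 0" for a
    proof (cases "kf k a = 0")
      case True
      then show ?thesis using off[of "a + c0"] off[of c0] c0 by simp
    qed (rule off)
    then have "\<kappa> n c0 = 0" by (intro kf_nondegenerate) (subst kf_sym)
    then show ?thesis using f[of u] by simp
  next
    case 2
    define \<sigma> where "\<sigma> = kf c0 (\<kappa> n c0)"
    have N: "\<kappa> n c0 = \<sigma> *s k" using main[of c0 c0] c0 2
      by (simp add: vec_eq_iff \<sigma>_def)
    have "\<kappa> n u $ i = (\<sigma> * kf k u) * k $ i" for i
    proof -
      have "- (kf k u * (\<sigma> * k $ i)) - \<kappa> n u $ i = - (2 * (\<sigma> * kf k u) * k $ i)"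
        using arg_cong[OF main[of u c0], of "\<lambda>w. w $ i"] c0 2 by (simp add: N kf_sym[of u k])
      then show ?thesis by algebra
    qed
    then show ?thesis by (simp add: vec_eq_iff \<sigma>_def kf_sym[of _ c0])
  qed
qed

lemma classify_nonzero: "\<exists>p. \<forall>t u. \<rho> t u = br k u + (poly p t * kf k u) *s k"
proof -
  obtain c where "kf k c \<noteq> 0" using kf_nondegenerate[of k] k0 by blast
  then have "kf k ((1 / kf k c) *s c) = 1" by simp
  then obtain c0 where c0: "kf k c0 = 1" by blast
  \<comment> \<open>Its constant term is \<open>kf [k, c0] c0 = 0\<close>, so the degree zero part of \<open>\<rho>\<close> stays \<open>[k, \<cdot>]\<close>.\<close>
  define p where "p = kf_poly (R (cur_const c0)) c0"
  have "R (cur_const u) = cur_const (br k u) + smult (kf k u) p *s cur_const k" for u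
  proof (rule cur_eqI_coeff)
    show "\<kappa> n u = vcoeff (cur_const (br k u) + smult (kf k u) p *s cur_const k) n" for n
      using coeff_rank_one[OF c0, of n u]
      by (cases n) (simp_all add: p_def coeff_0 kf_sym[of _ c0] mult.commute)
  qed
  then have "\<rho> t u = br k u + (poly p t * kf k u) *s k" for t u
    by (simp add: val_def mult.commute)
  then show ?thesis by blast
qed

end

text \<open>
  Oddness of \<open>p\<close> is the skew-adjointness of the second summand; the first is skew-adjoint on its
  own.
\<close>

lemma normal_form:
  obtains k n p where "n \<noteq> 0" "k = 0 \<or> k = n \<and> kf n n = 0" "odd_poly p"
    "\<And>t u. \<rho> t u = br k u + (poly p t * kf n u) *s n"
proof -
  have "\<exists>k n p. n \<noteq> 0 \<and> (k = 0 \<or> k = n \<and> kf n n = 0) \<and> (\<forall>t u. \<rho> t u = br k u + (poly p t * kf n u) *s n)"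
  proof -
    obtain k where k: "\<And>u. \<rho> 0 u = br k u" "kf k k = 0" using val_0_eq_br by blast
    show ?thesis
    proof (cases "k = 0")
      case True
      then have "\<rho> 0 u = 0" for u using k(1) by simp
      then obtain n p where "n \<noteq> 0" "\<forall>t u. \<rho> t u = (poly p t * kf n u) *s n"
        using classify_zero by blast
      then show ?thesis by (intro exI[of _ 0] exI[of _ n] exI[of _ p]) simp
    next
      case False
      obtain p where "\<forall>t u. \<rho> t u = br k u + (poly p t * kf k u) *s k"
        using classify_nonzero[OF k(1) False k(2)] by blast
      then show ?thesis using False k(2) by (intro exI[of _ k] exI[of _ p]) simp
    qed
  qed
  then obtain k n p where n: "n \<noteq> 0" "k = 0 \<or> k = n \<and> kf n n = 0"
    and \<rho>: "\<And>t u. \<rho> t u = br k u + (poly p t * kf n u) *s n" by blast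
  obtain u where u: "kf n u \<noteq> 0" using kf_nondegenerate n(1) by blast
  have "poly p (- t) = - poly p t" for t
  proof -
    have "poly p t * (kf n u * kf n u) = - (poly p (- t) * (kf n u * kf n u))"
      using skew[of t u u] by (simp add: \<rho> kf_sym[of _ u] kf_sym[of n u] kf_br_self mult_ac)
    then show ?thesis using u by (simp add: eq_neg_iff_add_eq_0 add.commute flip: ring_distribs)
  qed
  then have "odd_poly p" unfolding odd_poly_def by (intro poly_ext) (simp add: poly_pcompose)
  then show thesis using that n \<rho> by blast
qed

end

section \<open>Automorphisms of the current algebra\<close>

text \<open>
  Conjugation \<open>X \<mapsto> G X adj(G)\<close> by the matrix \<open>G\<close> with rows \<open>(p, q)\<close> and \<open>(r, s)\<close>, in the
  coordinates \<open>e, f, h\<close>. With the adjugate in place of the inverse it is polynomial in the entries, and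
  identities hold up to powers of the determinant.
\<close>

definition Ad :: "complex \<Rightarrow> complex \<Rightarrow> complex \<Rightarrow> complex \<Rightarrow> complex^3 \<Rightarrow> complex^3" where
  "Ad p q r s x = vector
     [p\<^sup>2 * x$1 - q\<^sup>2 * x$2 - 2 * p * q * x$3,
      s\<^sup>2 * x$2 - r\<^sup>2 * x$1 + 2 * r * s * x$3,
      (p * s + q * r) * x$3 + q * s * x$2 - p * r * x$1]"

lemma Ad_nth [simp]:
  "Ad p q r s x $ 1 = p\<^sup>2 * x$1 - q\<^sup>2 * x$2 - 2 * p * q * x$3"
  "Ad p q r s x $ 2 = s\<^sup>2 * x$2 - r\<^sup>2 * x$1 + 2 * r * s * x$3"
  "Ad p q r s x $ 3 = (p * s + q * r) * x$3 + q * s * x$2 - p * r * x$1"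
  by (simp_all add: Ad_def)

lemma Ad_br: "br (Ad p q r s x) (Ad p q r s y) = (p * s - q * r) *s Ad p q r s (br x y)"
  by (simp add: vec_eq_iff forall_3 algebra_simps power2_eq_square)

lemma kf_Ad: "kf (Ad p q r s x) (Ad p q r s y) = (p * s - q * r)\<^sup>2 * kf x y"
  by (simp add: kf_eq algebra_simps power2_eq_square)

lemma Ad_Ad: "Ad s (- q) (- r) p (Ad p q r s x) = (p * s - q * r)\<^sup>2 *s x"
  by (simp add: vec_eq_iff forall_3 algebra_simps power2_eq_square)

lemma Ad_linear: "Ad p q r s (x + y) = Ad p q r s x + Ad p q r s y"
  "Ad p q r s (c *s x) = c *s Ad p q r s x"
  by (simp_all add: vec_eq_iff forall_3 algebra_simps)

text \<open>
  Nonzero nilpotent and semisimple elements are conjugate to multiples of \<open>e\<close> and of \<open>h\<close>. A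
  nilpotent \<open>n\<close> equals \<open>G e G\<^sup>-\<^sup>1\<close> if its coordinates are \<open>p\<^sup>2\<close>, \<open>-r\<^sup>2\<close>, \<open>-p r\<close>, which asks for a square
  root. For a semisimple \<open>n\<close> the columns of \<open>G\<close> are eigenvectors for the eigenvalues \<open>m\<close>, \<open>-m\<close>.
\<close>

lemma Ad_orbit:
  assumes "n \<noteq> 0"
  obtains p q r s \<mu> where "p * s - q * r = 1" "\<mu> \<noteq> 0"
    "kf n n = 0 \<Longrightarrow> n = Ad p q r s (\<mu> *s axis 1 1)"
    "kf n n \<noteq> 0 \<Longrightarrow> n = Ad p q r s (\<mu> *s axis 3 1)"
proof (cases "kf n n = 0")
  case True
  then have iso: "n$1 * n$2 = - (n$3 * n$3)" by (simp add: kf_eq_0 mult.commute)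
  show thesis
  proof (cases "n$1 = 0")
    case n1: True
    then have n3: "n$3 = 0" using iso by simp
    then have n2: "n$2 \<noteq> 0" using \<open>n \<noteq> 0\<close> n1 by (simp add: vec_eq_iff forall_3)
    define r where "r = csqrt (- n$2)"
    have r: "r\<^sup>2 = - n$2" "r \<noteq> 0" using n2 by (simp_all add: r_def)
    show thesis
      by (rule that[where p = 0 and q = "- 1 / r" and r = r and s = 0 and \<mu> = 1])
         (use True r n1 n3 in \<open>auto simp: vec_eq_iff forall_3 axis_def\<close>)
  next
    case n1: False
    define p where "p = csqrt (n$1)"
    have p: "p\<^sup>2 = n$1" "p \<noteq> 0" using n1 by (simp_all add: p_def)
    have "n$2 = - (n$3)\<^sup>2 / p\<^sup>2" using iso n1 p by (simp add: field_simps power2_eq_square)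
    then show thesis
      by (intro that[where p = p and q = 0 and r = "- n$3 / p" and s = "1 / p" and \<mu> = 1])
         (use True p in \<open>auto simp: vec_eq_iff forall_3 axis_def power_divide\<close>)
  qed
next
  case False
  show thesis
  proof (cases "n$2 = 0")
    case n2: True
    then have "n$3 \<noteq> 0" using False by (simp add: kf_eq)
    then show thesis
      by (intro that[where p = 1 and q = "- n$1 / (2 * n$3)" and r = 0 and s = 1 and \<mu> = "n$3"])
         (use False n2 in \<open>auto simp: vec_eq_iff forall_3 axis_def\<close>)
  next
    case n2: False
    define m where "m = csqrt ((n$3)\<^sup>2 + n$1 * n$2)"
    have m2: "m\<^sup>2 = (n$3)\<^sup>2 + n$1 * n$2" by (simp add: m_def)
    have "m \<noteq> 0"
    proof
      assume "m = 0"
      then have "n$1 * n$2 = - (n$3 * n$3)" using m2 by (simp add: power2_eq_square eq_neg_iff_add_eq_0 add.commute)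
      then show False using False by (simp add: kf_eq_0 mult.commute)
    qed
    have "2 * (n$3 + m) * ((n$3 - m) / (2 * n$2 * m)) * m = ((n$3)\<^sup>2 - m\<^sup>2) / n$2"
      using \<open>m \<noteq> 0\<close> n2 by (simp add: field_simps power2_eq_square)
    also have "\<dots> = - n$1" using m2 n2 by simp
    finally have e: "2 * (n$3 + m) * ((n$3 - m) / (2 * n$2 * m)) * m = - n$1" .
    have h: "((n$3 + m) * (1 / (2 * m)) + (n$3 - m) / (2 * n$2 * m) * n$2) * m = n$3"
      and f: "2 * n$2 * (1 / (2 * m)) * m = n$2"
      and det: "(n$3 + m) * (1 / (2 * m)) - (n$3 - m) / (2 * n$2 * m) * n$2 = 1"
      using \<open>m \<noteq> 0\<close> n2 by (simp_all add: field_simps)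
    have n: "n = Ad (n$3 + m) ((n$3 - m) / (2 * n$2 * m)) (n$2) (1 / (2 * m)) (m *s axis 3 1)"
      unfolding vec_eq_iff forall_3 Ad_nth using e f h by (simp add: axis_def)
    show thesis
      by (rule that[OF det \<open>m \<noteq> 0\<close> _ n]) (use False in simp)
  qed
qed

definition lift :: "(complex^'n \<Rightarrow> complex^'n) \<Rightarrow> 'n::finite cur \<Rightarrow> 'n cur" where
  "lift g = cur_extension (\<lambda>u. cur_const (g u))"

lemma cur_const_axis: "cur_const (axis i 1) = axis i 1"
  by (simp add: cur_const_def vec_eq_iff axis_def)

lemma vec_basis_sum: "x = (\<Sum>i\<in>UNIV. x$i *s axis i (1::'a::comm_ring_1))"
  by (simp add: vec_eq_iff axis_def if_distrib[of "\<lambda>c. _ * c"] cong: if_cong)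

lemma cur_linear_eq_extension:
  assumes "cur_linear S"
  shows "S x = cur_extension (\<lambda>u. S (cur_const u)) x"
proof -
  interpret module_hom "(*s)" "(*s)" S by fact
  have "x = (\<Sum>i\<in>UNIV. x$i *s axis i 1)" by (rule vec_basis_sum)
  then have "S x = (\<Sum>i\<in>UNIV. x$i *s S (axis i 1))" by (metis (no_types, lifting) sum scale sum.cong)
  then show ?thesis by (simp add: cur_extension_def cur_const_axis)
qed

lemma pev_sum: "pev t (sum F S) = (\<Sum>i\<in>S. pev t (F i))"
  by (induction S rule: infinite_finite_induct) auto

locale sl2_automorphism =
  fixes g g' :: "complex^3 \<Rightarrow> complex^3"
  assumes add: "g (x + y) = g x + g y" "g' (x + y) = g' x + g' y"
    and scale: "g (c *s x) = c *s g x" "g' (c *s x) = c *s g' x"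
    and br: "g (br x y) = br (g x) (g y)"
    and kf: "kf (g x) (g y) = kf x y"
    and inverse: "g (g' x) = x" "g' (g x) = x"
begin

lemma zero: "g 0 = 0" "g' 0 = 0"
  using scale(1)[of 0 0] scale(2)[of 0 0] by simp_all

lemma sum: "g (sum F S) = (\<Sum>i\<in>S. g (F i))" "g' (sum F S) = (\<Sum>i\<in>S. g' (F i))"
  by (induction S rule: infinite_finite_induct) (auto simp: zero add)

lemma br': "g' (br x y) = br (g' x) (g' y)"
  by (metis br inverse)

lemma kf': "kf x (g y) = kf (g' x) y"
  by (metis kf inverse(1))

lemma pev_lift: "pev t (lift g V) = g (pev t V)" "pev t (lift g' V) = g' (pev t V)"
  by (subst (2) vec_basis_sum, simp add: lift_def cur_extension_def pev_sum sum scale, simp add: pev_def)+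

lemma lift_inverse: "lift g (lift g' V) = V" "lift g' (lift g V) = V"
  by (rule cur_ext, simp add: pev_lift inverse)+

lemma bij_lift: "bij (lift g)"
  by (rule bijI') (metis lift_inverse)+

lemma inv_lift: "inv (lift g) = lift g'"
  by (rule inv_equality) (simp_all add: lift_inverse)

end

text \<open>
  Evaluated, the \<open>\<lambda>\<close>-bracket is the bracket of \<open>sl\<^sub>2\<close> at the shifted points \<open>-\<lambda>\<close> and \<open>\<lambda> + \<partial>\<close>, so
  that preserving it is inherited from a constant automorphism.
\<close>

lemma lambda_ev_bracket_sl2:
  "lambda_ev (lambda_bracket br u v) a d x = br (pev (- d) u) (pev (d + x) v) $ a"
  using exhaust_3[of a]
  by (auto simp: lambda_ev_bracket sum_3 br_basis axis_def pev_def algebra_simps)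

lemma lambda_ev_eqI:
  fixes P Q :: "'n::finite cur poly"
  assumes "\<And>a d x. lambda_ev P a d x = lambda_ev Q a d x"
  shows "P = Q"
proof (rule poly_eqI, rule cur_ext)
  fix m x
  show "pev x (coeff P m) = pev x (coeff Q m)"
  proof (rule vec_eq_iff[THEN iffD2], rule allI)
    fix a
    let ?N = "max m (max (degree P) (degree Q))"
    let ?p = "\<lambda>P :: 'n cur poly. \<Sum>i\<le>?N. monom (poly (coeff P i $ a) x) i"
    have "?p P = ?p Q"
    proof (rule poly_ext)
      fix d
      show "poly (?p P) d = poly (?p Q) d"
        using assms[of a d x] by (simp add: lambda_ev_alt[where N = ?N] poly_sum poly_monom mult.commute)
    qed
    then have "coeff (?p P) m = coeff (?p Q) m" by simp
    then show "pev x (coeff P m) $ a = pev x (coeff Q m) $ a"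
      by (simp add: coeff_sum pev_def)
  qed
qed

context sl2_automorphism
begin

lemma lift_automorphism: "cur_automorphism br (lift g)"
  unfolding cur_automorphism_def
proof (intro conjI allI)
  show "cur_linear (lift g)" unfolding lift_def by (rule cur_linear_extension)
  show "bij (lift g)" by (rule bij_lift)
  have lift0: "lift g 0 = 0" by (rule cur_ext) (simp add: pev_lift zero)
  fix x y
  show "lambda_bracket br (lift g x) (lift g y) = map_poly (lift g) (lambda_bracket br x y)"
  proof (rule lambda_ev_eqI)
    fix a d z
    let ?P = "lambda_bracket br x y"
    have "lambda_ev (map_poly (lift g) ?P) a d z = (\<Sum>m\<le>degree ?P. d ^ m * poly (lift g (coeff ?P m) $ a) z)"
      by (subst lambda_ev_alt[OF map_poly_degree_leq]) (simp_all add: coeff_map_poly lift0)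
    also have "\<dots> = (\<Sum>m\<le>degree ?P. d ^ m * pev z (lift g (coeff ?P m)) $ a)"
      by (simp add: pev_def)
    also have "\<dots> = g (\<Sum>m\<le>degree ?P. d ^ m *s pev z (coeff ?P m)) $ a"
      by (simp add: pev_lift sum scale)
    also have "(\<Sum>m\<le>degree ?P. d ^ m *s pev z (coeff ?P m)) = (\<chi> a. lambda_ev ?P a d z)"
      by (simp add: lambda_ev_def pev_def vec_eq_iff)
    also have "\<dots> = br (pev (- d) x) (pev (d + z) y)"
      by (simp add: lambda_ev_bracket_sl2 vec_eq_iff)
    finally show "lambda_ev (lambda_bracket br (lift g x) (lift g y)) a d z =
        lambda_ev (map_poly (lift g) ?P) a d z"
      by (simp add: lambda_ev_bracket_sl2 pev_lift br)
  qed
qed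

lemma conjugate_const:
  assumes "\<And>t u. pev t (R (cur_const u)) = br k u + (poly p t * kf n u) *s n"
  shows "pev t (conjugate (lift g) R (cur_const u))
       = br (g' k) u + (poly p t * kf (g' n) u) *s g' n"
proof -
  have "lift g (cur_const u) = cur_const (g u)"
    by (rule cur_ext) (simp add: pev_lift)
  then show ?thesis
    by (simp add: conjugate_def inv_lift pev_lift assms add scale br' kf' inverse)
qed

lemma conjugate_linear:
  assumes "cur_linear R"
  shows "cur_linear (conjugate (lift g) R)"
  unfolding conjugate_def inv_lift unfolding lift_def
  by (rule module_hom_compose[OF cur_linear_extension module_hom_compose[OF assms cur_linear_extension]])

end

lemma Ad_automorphism:
  assumes "p * s - q * r = 1"
  shows "sl2_automorphism (Ad p q r s) (Ad s (- q) (- r) p)"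
proof
  show "Ad p q r s (Ad s (- q) (- r) p x) = x" for x
    using Ad_Ad[of p "- q" "- r" s x] assms by (simp add: mult.commute)
qed (use assms in \<open>simp_all add: Ad_br kf_Ad Ad_Ad Ad_linear\<close>)

section \<open>Classification and realisation\<close>

text \<open>
  For nilpotent \<open>k\<close> the triple product identity turns both sides of the Rota--Baxter equation into the
  same multiple \<open>- kf k [a, b] / 2\<close> of \<open>k\<close>; on the right-hand side the Jacobi identity first combines
  the two summands into \<open>[k, [a, b]]\<close>.
\<close>

lemma rota_baxter_br:
  assumes "kf k k = 0"
  shows "rota_baxter br (br k)"
  unfolding rota_baxter_def
proof (intro conjI allI)
  show "Vector_Spaces.linear (*s) (*s) (br k)"
    by unfold_locales simp_all
  fix a b
  have J: "br (br k a) b + br a (br k b) = br k (br a b)" by (rule jacobi[symmetric])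
  have "2 *s br (br k a) (br k b) = 2 *s br k (br k (br a b))"
  proof -
    have "2 *s br (br k a) (br k b) = kf (br k a) k *s b - kf (br k a) b *s k"
      by (rule br_br)
    also have "\<dots> = - kf k (br a b) *s k"
      by (simp add: kf_invariant kf_sym[of "br k a" k])
    also have "\<dots> = 2 *s br k (br k (br a b))"
      by (simp add: br_br assms)
    finally show ?thesis .
  qed
  then have "br (br k a) (br k b) = br k (br k (br a b))" by (simp add: vec_eq_iff)
  then show "br (br k a) (br k b) = br k (br (br k a) b + br a (br k b))"
    by (simp only: J)
qed

lemma classification:
  assumes "skew_symmetric r" "ccybe_solution br r"
  shows "\<exists>\<psi>. cur_automorphism br \<psi> \<and>
           ((\<exists>P. rota_baxter br P \<and> conjugate \<psi> (P0 br r) = cur_extension (\<lambda>u. cur_const (P u))) \<or>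
            (\<exists>q \<alpha>. q \<noteq> 0 \<and> odd_poly q \<and> R1_operator q \<alpha> (conjugate \<psi> (P0 br r))) \<or>
            (\<exists>q. q \<noteq> 0 \<and> odd_poly q \<and> R2_operator q (conjugate \<psi> (P0 br r))))"
proof -
  interpret cybe_operator "P0 br r" using cybe_operator_P0[OF assms] .
  obtain k n p where n: "n \<noteq> 0" and k: "k = 0 \<or> k = n \<and> kf n n = 0" and "odd_poly p"
    and \<rho>: "\<And>t u. \<rho> t u = br k u + (poly p t * kf n u) *s n"
    by (rule normal_form, rule that)
  obtain a b c d \<mu> where det: "a * d - b * c = 1" and "\<mu> \<noteq> 0"
    and nil: "kf n n = 0 \<Longrightarrow> n = Ad a b c d (\<mu> *s axis 1 1)"
    and ss: "kf n n \<noteq> 0 \<Longrightarrow> n = Ad a b c d (\<mu> *s axis 3 1)"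
    by (rule Ad_orbit[OF n], rule that)
  interpret G: sl2_automorphism "Ad a b c d" "Ad d (- b) (- c) a"
    by (rule Ad_automorphism[OF det])
  let ?g' = "Ad d (- b) (- c) a"
  define S where "S = conjugate (lift (Ad a b c d)) (P0 br r)"
  have lin: "cur_linear S" unfolding S_def by (rule G.conjugate_linear[OF lin])
  have S: "pev t (S (cur_const u)) = br (?g' k) u + (poly p t * kf (?g' n) u) *s ?g' n" for t u
    unfolding S_def by (rule G.conjugate_const) (use \<rho> in \<open>simp add: val_def\<close>)
  have odd: "odd_poly (smult c p)" for c
    using \<open>odd_poly p\<close> by (simp add: odd_poly_def pcompose_smult)
  consider "p = 0" | "p \<noteq> 0" "kf n n = 0" | "p \<noteq> 0" "kf n n \<noteq> 0" by blast
  then have "(\<exists>P. rota_baxter br P \<and> S = cur_extension (\<lambda>u. cur_const (P u))) \<or>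
             (\<exists>q \<alpha>. q \<noteq> 0 \<and> odd_poly q \<and> R1_operator q \<alpha> S) \<or>
             (\<exists>q. q \<noteq> 0 \<and> odd_poly q \<and> R2_operator q S)"
  proof cases
    case 1
    have "S (cur_const u) = cur_const (br (?g' k) u)" for u
      by (rule cur_ext) (simp add: S 1)
    then have "S = cur_extension (\<lambda>u. cur_const (br (?g' k) u))"
      by (intro ext) (subst cur_linear_eq_extension[OF lin], simp)
    moreover have "kf (?g' k) (?g' k) = 0"
      using k G.kf'[of k "?g' k"] by (auto simp: G.inverse)
    then have "rota_baxter br (br (?g' k))" by (rule rota_baxter_br)
    ultimately show ?thesis by (intro disjI1 exI[of _ "br (?g' k)"] conjI)
  next
    case 2
    have n': "?g' n = \<mu> *s axis 1 1"
      using arg_cong[OF nil[OF 2(2)], of ?g'] by (simp only: G.inverse)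
    have "?g' k = (if k = 0 then 0 else \<mu>) *s axis 1 1"
      using k n' G.zero(2) by auto
    then obtain \<alpha> where k': "?g' k = \<alpha> *s axis 1 1" by blast
    have "R1_operator (smult (4 * \<mu>\<^sup>2) p) \<alpha> S"
      unfolding R1_operator_def cur_const_axis[symmetric]
      by (intro conjI lin; rule cur_ext; simp only: S n' k' pev_simps; simp add: vec_eq_iff forall_3 axis_def kf_eq power2_eq_square)
    moreover have "smult (4 * \<mu>\<^sup>2) p \<noteq> 0" using 2(1) \<open>\<mu> \<noteq> 0\<close> by simp
    ultimately show ?thesis
      by (intro disjI2 disjI1 exI[of _ "smult (4 * \<mu>\<^sup>2) p"] exI[of _ \<alpha>] conjI odd)
  next
    case 3
    have n': "?g' n = \<mu> *s axis 3 1"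
      using arg_cong[OF ss[OF 3(2)], of ?g'] by (simp only: G.inverse)
    have k': "?g' k = 0" using k 3(2) G.zero(2) by auto
    have "R2_operator (smult (8 * \<mu>\<^sup>2) p) S"
      unfolding R2_operator_def cur_const_axis[symmetric]
      by (intro conjI lin; rule cur_ext; simp only: S n' k' pev_simps; simp add: vec_eq_iff forall_3 axis_def kf_eq power2_eq_square)
    moreover have "smult (8 * \<mu>\<^sup>2) p \<noteq> 0" using 3(1) \<open>\<mu> \<noteq> 0\<close> by simp
    ultimately show ?thesis
      by (intro disjI2 exI[of _ "smult (8 * \<mu>\<^sup>2) p"] conjI odd)
  qed
  then show ?thesis
    unfolding S_def by (intro exI[of _ "lift (Ad a b c d)"] conjI G.lift_automorphism)
qed

lemma P0_eqI:
  assumes lin: "cur_linear R"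
    and R: "\<And>i. R (axis i 1) = P0 br r (axis i 1)"
  shows "R = P0 br r"
proof
  have lin': "cur_linear (P0 br r)" unfolding P0_def by (rule cur_linear_extension)
  show "R x = P0 br r x" for x
    using cur_linear_eq_extension[OF lin, of x] cur_linear_eq_extension[OF lin', of x]
    by (simp add: cur_extension_def cur_const_axis R)
qed

text \<open>
  For (R1) and (R2) alike the polynomial \<open>q\<close> is spread over two variables as a multiple of
  \<open>q(y) - q(x)\<close>, which on the antidiagonal is a multiple of \<open>q\<close> by oddness. The constants undo the
  values \<open>kf e f = 4\<close> and \<open>kf h h = 8\<close>.
\<close>

lemma realisation:
  fixes q :: "complex poly"
  assumes q: "odd_poly q" and R: "R1_operator q \<alpha> R \<or> R2_operator q R"
  shows "\<exists>r. skew_symmetric r \<and> ccybe_solution br r \<and> R = P0 br r"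
proof -
  have odd: "poly q (- t) = - poly q t" for t
    using arg_cong[OF q[unfolded odd_poly_def], of "\<lambda>p. poly p t"] by (simp add: poly_pcompose)
  from R show ?thesis
  proof
    assume R1: "R1_operator q \<alpha> R"
    define ts :: "(3 cur \<times> 3 cur) list" where "ts =
      [(cur_e, smult (1/8) q *s cur_e), (smult (-1/8) q *s cur_e, cur_e),
       ([:\<alpha>/4:] *s cur_e, cur_h), ([:-\<alpha>/4:] *s cur_h, cur_e)]"
    define r where "r = (\<Sum>(a, b)\<leftarrow>ts. tensor2 a b)"
    have ev: "ev2 (r $ i $ j) x y =
        (if i = 1 \<and> j = 1 then (poly q y - poly q x) / 8 else
         if i = 1 \<and> j = 3 then \<alpha> / 4 else if i = 3 \<and> j = 1 then - \<alpha> / 4 else 0)" for i j x y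
      using exhaust_3[of i] exhaust_3[of j]
      by (auto simp: r_def ts_def axis_def field_simps)
    have M: "antidiag_ev r t i j =
        (if i = 1 \<and> j = 1 then poly q t / 4 else
         if i = 1 \<and> j = 3 then \<alpha> / 4 else if i = 3 \<and> j = 1 then - \<alpha> / 4 else 0)" for t i j
      by (simp add: antidiag_ev_def ev odd)
    have "skew_symmetric r"
      unfolding skew_symmetric_iff by (simp add: ev diff_divide_distrib)
    moreover have "ccybe_solution br r"
    proof (rule ccybe_solutionI[OF r_def])
      fix a b c :: 3 and x y z :: complex
      show "ccybe_ev br (antidiag_ev r) a b c x y z = 0"
        using exhaust_3[of a] exhaust_3[of b] exhaust_3[of c]
        by (auto simp: ccybe_ev_def M sum_3 axis_def odd)
    qed
    moreover have "R = P0 br r"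
    proof (rule P0_eqI)
      show "cur_linear R" using R1 by (simp add: R1_operator_def)
      have "pev t (R (axis i 1)) = val (P0 br r) t (axis i 1)" for t i
        using exhaust_3[of i] R1
        by (auto simp: R1_operator_def val_P0 M sum_3 kf_eq vec_eq_iff forall_3 axis_def pev_def)
      then show "R (axis i 1) = P0 br r (axis i 1)" for i
        by (intro cur_ext) (simp add: val_def cur_const_axis)
    qed
    ultimately show ?thesis by blast
  next
    assume R2: "R2_operator q R"
    define ts :: "(3 cur \<times> 3 cur) list" where "ts =
      [(cur_h, smult (1/16) q *s cur_h), (smult (-1/16) q *s cur_h, cur_h)]"
    define r where "r = (\<Sum>(a, b)\<leftarrow>ts. tensor2 a b)"
    have ev: "ev2 (r $ i $ j) x y = (if i = 3 \<and> j = 3 then (poly q y - poly q x) / 16 else 0)" for i j x y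
      using exhaust_3[of i] exhaust_3[of j]
      by (auto simp: r_def ts_def axis_def field_simps)
    have M: "antidiag_ev r t i j = (if i = 3 \<and> j = 3 then poly q t / 8 else 0)" for t i j
      by (simp add: antidiag_ev_def ev odd)
    have "skew_symmetric r"
      unfolding skew_symmetric_iff by (simp add: ev diff_divide_distrib)
    moreover have "ccybe_solution br r"
    proof (rule ccybe_solutionI[OF r_def])
      fix a b c :: 3 and x y z :: complex
      show "ccybe_ev br (antidiag_ev r) a b c x y z = 0"
        using exhaust_3[of a] exhaust_3[of b] exhaust_3[of c]
        by (auto simp: ccybe_ev_def M sum_3 axis_def odd)
    qed
    moreover have "R = P0 br r"
    proof (rule P0_eqI)
      show "cur_linear R" using R2 by (simp add: R2_operator_def)
      have "pev t (R (axis i 1)) = val (P0 br r) t (axis i 1)" for t i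
        using exhaust_3[of i] R2
        by (auto simp: R2_operator_def val_P0 M sum_3 kf_eq vec_eq_iff forall_3 axis_def pev_def)
      then show "R (axis i 1) = P0 br r (axis i 1)" for i
        by (intro cur_ext) (simp add: val_def cur_const_axis)
    qed
    ultimately show ?thesis by blast
  qed
qed

lemma cur_automorphism_id: "cur_automorphism br id"
proof -
  have "cur_linear (id :: 3 cur \<Rightarrow> 3 cur)"
    by unfold_locales (auto simp: vec_eq_iff algebra_simps)
  then show ?thesis by (simp add: cur_automorphism_def)
qed

theorem mainTheorem3:
  shows "(\<forall>r :: 3 cur2. skew_symmetric r \<and> ccybe_solution sl2_bracket r \<longrightarrow>
           (\<exists>\<psi>. cur_automorphism sl2_bracket \<psi> \<and>
             ((\<exists>P. rota_baxter sl2_bracket P \<and>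
                 conjugate \<psi> (P0 sl2_bracket r) = cur_extension (\<lambda>u. cur_const (P u))) \<or>
              (\<exists>q \<alpha>. q \<noteq> 0 \<and> odd_poly q \<and> R1_operator q \<alpha> (conjugate \<psi> (P0 sl2_bracket r))) \<or>
              (\<exists>q. q \<noteq> 0 \<and> odd_poly q \<and> R2_operator q (conjugate \<psi> (P0 sl2_bracket r))))))
       \<and> (\<forall>q \<alpha> R. q \<noteq> 0 \<and> odd_poly q \<and> (R1_operator q \<alpha> R \<or> R2_operator q R) \<longrightarrow>
           (\<exists>\<psi> (r :: 3 cur2). cur_automorphism sl2_bracket \<psi> \<and>
             skew_symmetric r \<and> ccybe_solution sl2_bracket r \<and>
             R = conjugate \<psi> (P0 sl2_bracket r)))"
proof (intro conjI allI impI)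
  fix r :: "3 cur2"
  assume "skew_symmetric r \<and> ccybe_solution sl2_bracket r"
  then have "skew_symmetric r" "ccybe_solution sl2_bracket r" by simp_all
  then show "\<exists>\<psi>. cur_automorphism sl2_bracket \<psi> \<and>
      ((\<exists>P. rota_baxter sl2_bracket P \<and>
          conjugate \<psi> (P0 sl2_bracket r) = cur_extension (\<lambda>u. cur_const (P u))) \<or>
       (\<exists>q \<alpha>. q \<noteq> 0 \<and> odd_poly q \<and> R1_operator q \<alpha> (conjugate \<psi> (P0 sl2_bracket r))) \<or>
       (\<exists>q. q \<noteq> 0 \<and> odd_poly q \<and> R2_operator q (conjugate \<psi> (P0 sl2_bracket r))))"
    by (rule classification)
next
  fix q \<alpha> R
  assume "q \<noteq> 0 \<and> odd_poly q \<and> (R1_operator q \<alpha> R \<or> R2_operator q R)"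
  then have "odd_poly q" "R1_operator q \<alpha> R \<or> R2_operator q R" by simp_all
  then obtain r where r: "skew_symmetric r" "ccybe_solution sl2_bracket r" "R = P0 sl2_bracket r"
    using realisation by metis
  have "R = conjugate id (P0 sl2_bracket r)" using r(3) by (simp add: conjugate_def)
  then show "\<exists>\<psi> (r :: 3 cur2). cur_automorphism sl2_bracket \<psi> \<and>
      skew_symmetric r \<and> ccybe_solution sl2_bracket r \<and> R = conjugate \<psi> (P0 sl2_bracket r)"
    by (intro exI[of _ id] exI[of _ r] conjI cur_automorphism_id r(1,2))
qed

end
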